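(* Let $G$ be a finite loop-free graph with maximum degree $D$, and let $k\ge1$ be an integer. There is a $\mathbb{Z}_2$-map $g\colon|\mathrm{B}(\Omega_{2k+1}(G))|\to|\mathrm{B}(G)|$ such that: (1) $g$ is $\mathbb{Z}_2$-homotopic to the map $|p|$ induced by the homomorphism $p\colon\Omega_{2k+1}(G)\to G$, $(\{v\},A_1,\dots,A_k)\mapsto v$; (2) in particular, $g$ is a $\mathbb{Z}_2$-homotopy equivalence; (3) $g$ maps every simplex of $|\mathrm{B}(\Omega_{2k+1}(G))|$ into a subset of $|\mathrm{B}(G)|$ of (Euclidean) diameter less than $\frac{6D}{k}$.
   Context: Graphs are finite with symmetric adjacency. For $A,B\subseteq V(G)$, $A\bowtie B$ means every vertex of $A$ is adjacent to every vertex of $B$; $\mathrm{CN}(A)$ is the common neighbourhood ($\mathrm{CN}(\emptyset)=V(G)$). For $k'=2\ell+1$, $\Omega_{k'}(G)$ has vertices the tuples $(A_0,\dots,A_\ell)$ of subsets of $V(G)$ with $|A_0|=1$ and $A_{i-1}\bowtie A_i$; $\mathbf{A},\mathbf{B}$ are adjacent iff $A_{i-1}\subseteq B_i$, $B_{i-1}\subseteq A_i$ ($i=1,\dots,\ell$) and $A_\ell\bowtie B_\ell$. Box complex: after deleting isolated vertices of a graph $H$, $\mathrm{B}(H)$ is the simplicial complex on $V(H)\times\{\circ,\bullet\}$ whose simplices are the nonempty $\sigma$ with $\sigma^\circ\bowtie\sigma^\bullet$ and $\mathrm{CN}(\sigma^\circ),\mathrm{CN}(\sigma^\bullet)\ne\emptyset$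 ($\sigma^\circ=\{v:v^\circ\in\sigma\}$, $\sigma^\bullet=\{v:v^\bullet\in\sigma\}$), with involution $v^\circ\leftrightarrow v^\bullet$. $|\mathrm{B}(H)|$ is its geometric realization: the union, over simplices, of the convex hulls of the standard basis vectors $e_u$ ($u$ in the simplex) in $\mathbb{R}^{V(\mathrm{B}(H))}$, with the Euclidean metric and the linearly extended involution. A homomorphism $h$ induces $|h|$, the linear extension of $v^\circ\mapsto h(v)^\circ$, $v^\bullet\mapsto h(v)^\bullet$. A $\mathbb{Z}_2$-map is continuous and commutes with involutions; $\mathbb{Z}_2$-homotopic means homotopic through $\mathbb{Z}_2$-maps; a $\mathbb{Z}_2$-homotopy equivalence is a $\mathbb{Z}_2$-map with a $\mathbb{Z}_2$-homotopy inverse. *)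

theory Defs
  imports "HOL-Analysis.Analysis" "Graph_Theory.Pair_Digraph"
begin

section \<open>Graphs\<close>

text \<open>Finite graphs with symmetric adjacency are \<^term>\<open>pair_pseudo_graph G\<close> (loops allowed)
  and, without loops, \<^term>\<open>pair_graph G\<close>.\<close>

definition joined :: "'a pair_pre_digraph \<Rightarrow> 'a set \<Rightarrow> 'a set \<Rightarrow> bool" where
  "joined G A B \<longleftrightarrow> (\<forall>a\<in>A. \<forall>b\<in>B. (a, b) \<in> parcs G)"

definition common_nbh :: "'a pair_pre_digraph \<Rightarrow> 'a set \<Rightarrow> 'a set" where
  "common_nbh G A = {v \<in> pverts G. \<forall>a\<in>A. (a, v) \<in> parcs G}"

text \<open>For a symmetric graph the out-degree is the degree. The inserted \<open>0\<close> only matters for the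
  graph without vertices, whose maximum degree is taken to be \<open>0\<close>.\<close>

definition max_degree :: "'a pair_pre_digraph \<Rightarrow> nat" where
  "max_degree G = Max (insert 0 (out_degree (with_proj G) ` pverts G))"

text \<open>\<open>Omega l G\<close> is the graph $\Omega_{2l+1}(G)$; the tuple $(A_0,\dots,A_l)$ is a list of
  length \<open>l + 1\<close>.\<close>

definition Omega_verts :: "nat \<Rightarrow> 'a pair_pre_digraph \<Rightarrow> 'a set list set" where
  "Omega_verts l G = {A. length A = l + 1 \<and> (\<forall>i\<le>l. A ! i \<subseteq> pverts G) \<and> card (A ! 0) = 1 \<and>
      (\<forall>i\<in>{1..l}. joined G (A ! (i - 1)) (A ! i))}"

definition Omega :: "nat \<Rightarrow> 'a pair_pre_digraph \<Rightarrow> 'a set list pair_pre_digraph" where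
  "Omega l G = \<lparr> pverts = Omega_verts l G,
     parcs = {(A, B). A \<in> Omega_verts l G \<and> B \<in> Omega_verts l G \<and>
       (\<forall>i\<in>{1..l}. A ! (i - 1) \<subseteq> B ! i \<and> B ! (i - 1) \<subseteq> A ! i) \<and>
       joined G (A ! l) (B ! l)} \<rparr>"

definition Omega_proj :: "'a set list \<Rightarrow> 'a" where
  "Omega_proj A = the_elem (A ! 0)"

lemma Omega_pseudo_graph:
  assumes "pair_pseudo_graph G"
  shows "pair_pseudo_graph (Omega l G)"
proof -
  interpret pair_pseudo_graph G by fact
  have "Omega_verts l G \<subseteq> {A. set A \<subseteq> Pow (pverts G) \<and> length A = l + 1}"
    by (auto simp: Omega_verts_def in_set_conv_nth less_Suc_eq_le subset_iff)
  moreover have "finite {A. set A \<subseteq> Pow (pverts G) \<and> length A = l + 1}"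
    by (rule finite_lists_length_eq) (use pair_finite_verts in simp)
  ultimately have fin: "finite (Omega_verts l G)"
    by (rule finite_subset)
  have "parcs (Omega l G) \<subseteq> Omega_verts l G \<times> Omega_verts l G"
    by (auto simp: Omega_def)
  then have "finite (parcs (Omega l G))"
    using fin finite_subset by blast
  moreover have "symmetric (with_proj (Omega l G))"
    unfolding symmetric_def
  proof (rule symI)
    fix A B
    assume "(A, B) \<in> arcs_ends (with_proj (Omega l G))"
    then have AB: "(A, B) \<in> parcs (Omega l G)" by simp
    then have "joined G (B ! l) (A ! l)"
      unfolding joined_def Omega_def by simp (meson arcs_symmetric)
    with AB show "(B, A) \<in> arcs_ends (with_proj (Omega l G))"
      by (simp add: Omega_def)
  qed
  ultimately show ?thesis
    using fin by unfold_locales (auto simp: Omega_def)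
qed

lemma Omega_proj_hom:
  assumes "pair_pseudo_graph G"
  shows "A \<in> pverts (Omega l G) \<Longrightarrow> Omega_proj A \<in> pverts G"
    and "(A, B) \<in> parcs (Omega l G) \<Longrightarrow> (Omega_proj A, Omega_proj B) \<in> parcs G"
proof -
  interpret pair_pseudo_graph G by fact
  have proj: "A ! 0 = {Omega_proj A}" if "A \<in> Omega_verts l G" for A
  proof -
    have "card (A ! 0) = 1"
      using that unfolding Omega_verts_def by blast
    then obtain v where "A ! 0 = {v}"
      by (rule card_1_singletonE)
    then show ?thesis by (simp add: Omega_proj_def)
  qed
  show "Omega_proj A \<in> pverts G" if "A \<in> pverts (Omega l G)"
  proof -
    have A: "A \<in> Omega_verts l G"
      using that by (simp add: Omega_def)
    then have "A ! 0 \<subseteq> pverts G"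
      unfolding Omega_verts_def by blast
    with proj[OF A] show ?thesis by simp
  qed
  show "(Omega_proj A, Omega_proj B) \<in> parcs G" if AB: "(A, B) \<in> parcs (Omega l G)"
  proof (cases "l = 0")
    case True
    have A: "A \<in> Omega_verts l G" and B: "B \<in> Omega_verts l G"
      using AB by (simp_all add: Omega_def)
    note proj[OF A] proj[OF B]
    moreover have "joined G (A ! 0) (B ! 0)"
      using AB True by (simp add: Omega_def)
    ultimately show ?thesis by (simp add: joined_def)
  next
    case False
    then have one: "1 \<in> {1..l}" by simp
    from AB have A: "A \<in> Omega_verts l G" and B: "B \<in> Omega_verts l G"
      and sub: "\<forall>i\<in>{1..l}. A ! (i - 1) \<subseteq> B ! i \<and> B ! (i - 1) \<subseteq> A ! i"
      by (simp_all add: Omega_def)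
    note proj[OF A] proj[OF B]
    moreover have "A ! 0 \<subseteq> B ! 1"
      using bspec[OF sub one] by simp
    moreover have "\<forall>i\<in>{1..l}. joined G (B ! (i - 1)) (B ! i)"
      using B unfolding Omega_verts_def by blast
    then have "joined G (B ! 0) (B ! 1)"
      using one by (metis diff_self_eq_0)
    ultimately have "(Omega_proj B, Omega_proj A) \<in> parcs G"
      by (simp add: joined_def)
    then show ?thesis by (rule arcs_symmetric)
  qed
qed


section \<open>Geometric realizations\<close>

text \<open>A simplicial complex is given by its set of (nonempty, finite) simplices; its vertex set
  is the union of these. A vector of \<open>\<real>\<^sup>V\<close> is a function vanishing outside \<open>V\<close>.\<close>

definition vec_metric :: "'u set \<Rightarrow> ('u \<Rightarrow> real) metric" where
  "vec_metric V = metric ({x. \<forall>u. u \<notin> V \<longrightarrow> x u = 0}, \<lambda>x y. L2_set (\<lambda>u. x u - y u) V)"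

definition basis_vec :: "'u \<Rightarrow> 'u \<Rightarrow> real" where
  "basis_vec u = (\<lambda>w. if w = u then 1 else 0)"

text \<open>The convex hull of the basis vectors indexed by \<open>\<sigma>\<close>.\<close>

definition geom_simplex :: "'u set \<Rightarrow> ('u \<Rightarrow> real) set" where
  "geom_simplex \<sigma> = {(\<lambda>w. \<Sum>u\<in>\<sigma>. t u * basis_vec u w) | t. (\<forall>u\<in>\<sigma>. 0 \<le> t u) \<and> (\<Sum>u\<in>\<sigma>. t u) = 1}"

definition realization :: "'u set set \<Rightarrow> ('u \<Rightarrow> real) metric" where
  "realization K = submetric (vec_metric (\<Union>K)) (\<Union>\<sigma>\<in>K. geom_simplex \<sigma>)"

text \<open>The linear map on \<open>\<real>\<^sup>V\<close> sending the basis vector of \<open>u\<close> to that of \<open>f u\<close>.\<close>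

definition linear_ext :: "'u set \<Rightarrow> ('u \<Rightarrow> 'w) \<Rightarrow> ('u \<Rightarrow> real) \<Rightarrow> ('w \<Rightarrow> real)" where
  "linear_ext V f x = (\<lambda>w. \<Sum>u\<in>V. x u * basis_vec (f u) w)"

text \<open>The analogue of \<^const>\<open>diameter\<close> for abstract metric spaces.\<close>

definition mdiameter :: "'x metric \<Rightarrow> 'x set \<Rightarrow> real" where
  "mdiameter m S = (if S = {} then 0 else SUP (x, y)\<in>S \<times> S. mdist m x y)"

lemma vec_metric_simps:
  assumes "finite V"
  shows "mspace (vec_metric V) = {x. \<forall>u. u \<notin> V \<longrightarrow> x u = 0}"
    and "mdist (vec_metric V) = (\<lambda>x y. L2_set (\<lambda>u. x u - y u) V)"
proof -
  interpret Metric_space "{x :: 'a \<Rightarrow> real. \<forall>u. u \<notin> V \<longrightarrow> x u = 0}"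
      "\<lambda>x y. L2_set (\<lambda>u. x u - y u) V"
  proof
    fix x y z :: "'a \<Rightarrow> real"
    show "L2_set (\<lambda>u. x u - y u) V = L2_set (\<lambda>u. y u - x u) V"
      by (simp add: L2_set_def power2_commute)
    show "L2_set (\<lambda>u. x u - z u) V \<le> L2_set (\<lambda>u. x u - y u) V + L2_set (\<lambda>u. y u - z u) V"
      using L2_set_triangle_ineq[of "\<lambda>u. x u - y u" "\<lambda>u. y u - z u" V] by simp
    assume "x \<in> {x. \<forall>u. u \<notin> V \<longrightarrow> x u = 0}" "y \<in> {x. \<forall>u. u \<notin> V \<longrightarrow> x u = 0}"
    then have "(\<forall>u\<in>V. x u = y u) \<longleftrightarrow> x = y"
      unfolding fun_eq_iff mem_Collect_eq by metis
    then show "L2_set (\<lambda>u. x u - y u) V = 0 \<longleftrightarrow> x = y"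
      using assms by (simp add: L2_set_eq_0_iff)
  qed (simp add: L2_set_nonneg)
  show "mspace (vec_metric V) = {x. \<forall>u. u \<notin> V \<longrightarrow> x u = 0}"
    "mdist (vec_metric V) = (\<lambda>x y. L2_set (\<lambda>u. x u - y u) V)"
    by (simp_all add: vec_metric_def)
qed

lemma mspace_realization:
  assumes "finite (\<Union>K)"
  shows "mspace (realization K) = (\<Union>\<sigma>\<in>K. geom_simplex \<sigma>)"
proof -
  have "x u = 0" if "\<sigma> \<in> K" "x \<in> geom_simplex \<sigma>" "u \<notin> \<Union>K" for \<sigma> x u
    using that by (auto simp: geom_simplex_def basis_vec_def intro!: sum.neutral)
  then show ?thesis
    using assms by (auto simp: realization_def vec_metric_simps)
qed


section \<open>Spaces with involution\<close>

text \<open>A space with involution is a pair of a topology and the involution.\<close>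

type_synonym 'x z2_space = "'x topology \<times> ('x \<Rightarrow> 'x)"

definition equivariant :: "'x z2_space \<Rightarrow> 'y z2_space \<Rightarrow> ('x \<Rightarrow> 'y) \<Rightarrow> bool" where
  "equivariant X Y f \<longleftrightarrow> (\<forall>x\<in>topspace (fst X). f (snd X x) = snd Y (f x))"

definition Z2_map :: "'x z2_space \<Rightarrow> 'y z2_space \<Rightarrow> ('x \<Rightarrow> 'y) \<Rightarrow> bool" where
  "Z2_map X Y f \<longleftrightarrow> continuous_map (fst X) (fst Y) f \<and> equivariant X Y f"

definition Z2_homotopic :: "'x z2_space \<Rightarrow> 'y z2_space \<Rightarrow> ('x \<Rightarrow> 'y) \<Rightarrow> ('x \<Rightarrow> 'y) \<Rightarrow> bool" where
  "Z2_homotopic X Y f g \<longleftrightarrow> homotopic_with (equivariant X Y) (fst X) (fst Y) f g"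

definition Z2_homotopy_equivalence :: "'x z2_space \<Rightarrow> 'y z2_space \<Rightarrow> ('x \<Rightarrow> 'y) \<Rightarrow> bool" where
  "Z2_homotopy_equivalence X Y f \<longleftrightarrow> Z2_map X Y f \<and>
     (\<exists>f'. Z2_map Y X f' \<and> Z2_homotopic X X (f' \<circ> f) id \<and> Z2_homotopic Y Y (f \<circ> f') id)"


section \<open>The box complex\<close>

definition remove_isolated :: "'a pair_pre_digraph \<Rightarrow> 'a pair_pre_digraph" where
  "remove_isolated H = \<lparr> pverts = {v \<in> pverts H. \<exists>w. (v, w) \<in> parcs H}, parcs = parcs H \<rparr>"

text \<open>The vertices $v^\circ$ and $v^\bullet$ are \<open>(v, False)\<close> and \<open>(v, True)\<close>.\<close>

definition side :: "bool \<Rightarrow> ('a \<times> bool) set \<Rightarrow> 'a set" where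
  "side b \<sigma> = {v. (v, b) \<in> \<sigma>}"

definition box_complex :: "'a pair_pre_digraph \<Rightarrow> ('a \<times> bool) set set" where
  "box_complex H = (let H' = remove_isolated H in
     {\<sigma>. \<sigma> \<noteq> {} \<and> \<sigma> \<subseteq> pverts H' \<times> UNIV \<and> joined H' (side False \<sigma>) (side True \<sigma>) \<and>
        common_nbh H' (side False \<sigma>) \<noteq> {} \<and> common_nbh H' (side True \<sigma>) \<noteq> {}})"

definition box_real :: "'a pair_pre_digraph \<Rightarrow> ('a \<times> bool \<Rightarrow> real) metric" where
  "box_real H = realization (box_complex H)"

definition box_space :: "'a pair_pre_digraph \<Rightarrow> ('a \<times> bool \<Rightarrow> real) z2_space" where
  "box_space H = (mtopology_of (box_real H), linear_ext (\<Union>(box_complex H)) (\<lambda>(v, b). (v, \<not> b)))"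

text \<open>The map induced by a homomorphism \<open>h\<close> from \<open>H\<close> to another graph.\<close>

definition box_map ::
    "'a pair_pre_digraph \<Rightarrow> ('a \<Rightarrow> 'b) \<Rightarrow> ('a \<times> bool \<Rightarrow> real) \<Rightarrow> ('b \<times> bool \<Rightarrow> real)" where
  "box_map H h = linear_ext (\<Union>(box_complex H)) (\<lambda>(v, b). (h v, b))"

lemma Union_box_complex:
  assumes "pair_pseudo_graph H"
  shows "\<Union>(box_complex H) = {v \<in> pverts H. \<exists>w. (v, w) \<in> parcs H} \<times> UNIV"
proof -
  interpret pair_pseudo_graph H by fact
  have "{(v, b)} \<in> box_complex H" if "v \<in> pverts H" "(v, w) \<in> parcs H" for v w b
  proof -
    have "w \<in> pverts H" "(w, v) \<in> parcs H"
      using in_arcsD2[OF that(2)] arcs_symmetric[OF that(2)] by auto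
    then show ?thesis
      using that by (cases b)
        (auto simp: box_complex_def remove_isolated_def side_def joined_def common_nbh_def)
  qed
  then have "{v \<in> pverts H. \<exists>w. (v, w) \<in> parcs H} \<times> UNIV \<subseteq> \<Union>(box_complex H)"
    by blast
  moreover have "\<Union>(box_complex H) \<subseteq> {v \<in> pverts H. \<exists>w. (v, w) \<in> parcs H} \<times> UNIV"
    unfolding box_complex_def remove_isolated_def Let_def pair_pre_digraph.simps by blast
  ultimately show ?thesis by blast
qed

lemma finite_Union_box_complex:
  assumes "pair_pseudo_graph H"
  shows "finite (\<Union>(box_complex H))"
proof -
  interpret pair_pseudo_graph H by fact
  show ?thesis
    unfolding Union_box_complex[OF assms] using pair_finite_verts by simp
qed

end

theory Submission
  imports Defs
begin

text \<open>A non-isolated vertex $(A_0,\dots,A_k)$ of $\Omega_{2k+1}(G)$, placed on one side, is sent to the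
  average of the barycentres of its coordinates $A_i$, the even ones taken on the same side and the
  odd ones on the other. Extended linearly, this gives \<open>g\<close>: a simplex of the box complex of
  $\Omega_{2k+1}(G)$ is sent into a single simplex of the box complex of \<open>G\<close>, one that also contains
  its image under \<open>p\<close>, so \<open>g\<close> and \<open>|p|\<close> are linearly homotopic. For adjacent tuples \<open>A\<close>, \<open>B\<close>
  the difference of the two averages is an alternating sum along the chains
  $A_0\subseteq B_1\subseteq A_2\subseteq\dots$ and $B_0\subseteq A_1\subseteq B_2\subseteq\dots$ of
  sets of size at most \<open>D\<close>; all but \<open>2 (D - 1)\<close> of their steps are trivial, whence the factor
  \<open>D / k\<close>.

  That \<open>|p|\<close> is a homotopy equivalence is shown one coordinate at a time. A point of the box complex of
  $\Omega_{2l+1}(G)$ is lifted by appending to each vertex of large weight on one side the union of the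
  last coordinates of a superlevel set of the weights on the other side. All homotopies needed are
  again linear.\<close>

section \<open>Realizations and box complexes\<close>

text \<open>The difficulty is a homotopy inverse to the map that forgets the last coordinate. A
  vertex on one side would naturally be extended by the last coordinates of everything present on
  the other side, but that set jumps as weights tend to 0, and it is empty when the other side is.
  Jumps are avoided by choosing the set at random, with probabilities continuous in the point;
  emptiness is avoided by a gradual switch to common neighbourhoods computed from the side at hand.
  All outcomes possible at one point must then be compatible. This is arranged by three consecutive
  weight windows: the lowest randomises the sets, the middle one governs the switch, and only
  vertices above both are lifted. A vertex present with small weight may be missed by the random
  sets, so the lift of a projected point need not share a simplex with that point; hence a detour
  through the point with its light fibres removed.\<close>

lemma geom_simplex_iff:
  assumes "finite \<sigma>"
  shows "x \<in> geom_simplex \<sigma> \<longleftrightarrow> (\<forall>u. 0 \<le> x u) \<and> (\<forall>u. u \<notin> \<sigma> \<longrightarrow> x u = 0) \<and> sum x \<sigma> = 1"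
proof -
  have eq: "(\<Sum>u\<in>\<sigma>. t u * basis_vec u w) = (if w \<in> \<sigma> then t w else 0)" for t :: "_ \<Rightarrow> real" and w
    using assms by (simp add: basis_vec_def sum.delta' if_distrib[of "(*) _"] cong: if_cong)
  show ?thesis
  proof
    assume "x \<in> geom_simplex \<sigma>"
    then show "(\<forall>u. 0 \<le> x u) \<and> (\<forall>u. u \<notin> \<sigma> \<longrightarrow> x u = 0) \<and> sum x \<sigma> = 1"
      by (auto simp: geom_simplex_def eq)
  next
    assume "(\<forall>u. 0 \<le> x u) \<and> (\<forall>u. u \<notin> \<sigma> \<longrightarrow> x u = 0) \<and> sum x \<sigma> = 1"
    then show "x \<in> geom_simplex \<sigma>"
      unfolding geom_simplex_def eq by (auto intro!: exI[of _ x])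
  qed
qed

definition underlying :: "'u set set \<Rightarrow> ('u \<Rightarrow> real) set" where
  "underlying K = (\<Union>\<sigma>\<in>K. geom_simplex \<sigma>)"

text \<open>Only finitely many coordinates vary on the realization, so the Euclidean metric induces
  the product topology there. Continuity can thus be checked coordinate by coordinate.\<close>

lemma mtopology_of_realization:
  fixes K :: "'u set set"
  assumes fin: "finite (\<Union>K)"
  shows "mtopology_of (realization K) = top_of_set (underlying K)"
proof -
  let ?m = "realization K"
  let ?V = "\<Union>K"
  have sp: "mspace ?m = underlying K"
    using mspace_realization[OF fin] by (simp add: underlying_def)
  have dist: "mdist ?m x y = L2_set (\<lambda>u. x u - y u) ?V" for x y
    by (simp add: realization_def vec_metric_simps[OF fin])
  have zero: "x u = 0" if "x \<in> underlying K" "u \<notin> ?V" for x u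
    using that by (auto simp: underlying_def geom_simplex_def basis_vec_def intro!: sum.neutral)
  have topsp: "topspace (mtopology_of ?m) = underlying K"
    by (simp add: sp)
  have coord: "continuous_map (mtopology_of ?m) euclideanreal (\<lambda>x. x u)" for u
  proof (cases "u \<in> ?V")
    case True
    have "Lipschitz_continuous_map ?m euclidean_metric (\<lambda>x. x u)"
      unfolding Lipschitz_continuous_map_def
    proof (intro conjI exI[of _ 1] ballI)
      fix x y
      show "mdist euclidean_metric (x u) (y u) \<le> 1 * mdist ?m x y"
        using member_le_L2_set[OF fin True, of "\<lambda>u. \<bar>x u - y u\<bar>"]
        by (simp add: dist dist_real_def L2_set_def)
    qed simp
    from Lipschitz_continuous_imp_continuous_map[OF this] show ?thesis
      by simp
  next
    case False
    show ?thesis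
      by (rule continuous_map_eq[of _ _ "\<lambda>_. 0"]) (use zero False topsp in auto)
  qed
  have id1: "continuous_map (mtopology_of ?m) (top_of_set (underlying K)) id"
  proof -
    have "continuous_map (mtopology_of ?m) (product_topology (\<lambda>u. euclideanreal) UNIV) id"
      using coord by (simp add: continuous_map_componentwise_UNIV)
    then show ?thesis
      by (simp add: euclidean_product_topology[symmetric] continuous_map_in_subtopology sp)
  qed
  have id2: "continuous_map (top_of_set (underlying K)) (mtopology_of ?m) id"
    unfolding mtopology_of_def Metric_space.continuous_map_to_metric[OF Metric_space_mspace_mdist]
  proof (intro ballI allI impI)
    fix x \<epsilon> assume x: "x \<in> topspace (top_of_set (underlying K))" and e: "(\<epsilon>::real) > 0"
    \<comment> \<open>The distance is at most the sum of \<open>card ?V\<close> coordinate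
      differences; the extra 1 keeps the bound strict and the quotient defined when
      \<open>?V\<close> is empty.\<close>
    define \<delta> where "\<delta> = \<epsilon> / (card ?V + 1)"
    have d: "\<delta> > 0" using e by (simp add: \<delta>_def)
    define U where "U = underlying K \<inter> (\<Inter>u\<in>?V. {y. dist (y u) (x u) < \<delta>})"
    have "open (\<Inter>u\<in>?V. {y :: 'u \<Rightarrow> real. dist (y u) (x u) < \<delta>})"
      using fin by (intro open_INT ballI open_Collect_less continuous_intros
          continuous_on_product_coordinates) auto
    then have "openin (top_of_set (underlying K)) U"
      by (auto simp: U_def openin_open)
    moreover have "x \<in> U" using x d by (auto simp: U_def)
    moreover have "id y \<in> Metric_space.mball (mspace ?m) (mdist ?m) (id x) \<epsilon>" if "y \<in> U" for y
    proof -
      have "L2_set (\<lambda>u. x u - y u) ?V \<le> (\<Sum>u\<in>?V. \<bar>x u - y u\<bar>)"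
        by (rule L2_set_le_sum_abs)
      also have "\<dots> \<le> (\<Sum>u\<in>?V. \<delta>)"
        using that by (intro sum_mono) (auto simp: U_def dist_real_def abs_minus_commute less_imp_le)
      also have "\<dots> = card ?V * \<delta>" by simp
      also have "\<dots> < (card ?V + 1) * \<delta>" using d by simp
      also have "\<dots> = \<epsilon>" by (simp add: \<delta>_def add_nonneg_eq_0_iff)
      finally show ?thesis
        using x that unfolding Metric_space.in_mball[OF Metric_space_mspace_mdist]
          by (simp add: dist sp U_def)
    qed
    ultimately show "\<exists>U. openin (top_of_set (underlying K)) U \<and> x \<in> U \<and> (\<forall>y\<in>U. id y \<in> Metric_space.mball (mspace ?m) (mdist ?m) (id x) \<epsilon>)"
      by blast
  qed
  show ?thesis
    using id1 id2 topsp by (metis homeomorphic_maps_def homeomorphic_maps_id topspace_euclidean_subtopology id_apply)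
qed

text \<open>The explicit neighbours absorb the deletion of isolated vertices: a vertex on side
  \<open>b\<close> has the neighbour \<open>c\<close>, so it is not isolated.\<close>

lemma box_complex_iff:
  assumes "pair_pseudo_graph H"
  shows "\<sigma> \<in> box_complex H \<longleftrightarrow> \<sigma> \<noteq> {} \<and>
    (\<forall>v w b. (v, b) \<in> \<sigma> \<longrightarrow> (w, \<not> b) \<in> \<sigma> \<longrightarrow> (v, w) \<in> parcs H) \<and>
    (\<forall>b. \<exists>c. \<forall>v. (v, b) \<in> \<sigma> \<longrightarrow> (v, c) \<in> parcs H)"
    (is "?L \<longleftrightarrow> ?R")
proof -
  interpret pair_pseudo_graph H by fact
  show ?thesis
  proof
    assume L: ?L
    then have ne: "\<sigma> \<noteq> {}" and j: "joined (remove_isolated H) (side False \<sigma>) (side True \<sigma>)"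
      and c: "common_nbh (remove_isolated H) (side b \<sigma>) \<noteq> {}" for b
      by (cases b; simp add: box_complex_def Let_def)+
    have "(v, w) \<in> parcs H" if "(v, b) \<in> \<sigma>" "(w, \<not> b) \<in> \<sigma>" for v w b
      using j that by (cases b)
        (auto simp: joined_def remove_isolated_def side_def intro: arcs_symmetric)
    moreover have "\<exists>c. \<forall>v. (v, b) \<in> \<sigma> \<longrightarrow> (v, c) \<in> parcs H" for b
      using c[of b] by (auto simp: common_nbh_def remove_isolated_def side_def)
    ultimately show ?R using ne by blast
  next
    assume R: ?R
    have arc: "(v, c) \<in> parcs H \<Longrightarrow> v \<in> pverts (remove_isolated H) \<and> c \<in> pverts (remove_isolated H)" for v c
      using in_arcsD1[of v c] in_arcsD2[of v c] arcs_symmetric[of v c]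
      by (auto simp: remove_isolated_def)
    have sub: "\<sigma> \<subseteq> pverts (remove_isolated H) \<times> UNIV"
    proof
      fix u assume u: "u \<in> \<sigma>"
      obtain v b where vb: "u = (v, b)" by force
      then obtain c where "(v, c) \<in> parcs H" using R u by blast
      then show "u \<in> pverts (remove_isolated H) \<times> UNIV" using arc vb by blast
    qed
    have cn: "common_nbh (remove_isolated H) (side b \<sigma>) \<noteq> {}" for b
    proof (cases "side b \<sigma> = {}")
      \<comment> \<open>An empty side has every non-isolated vertex as a common neighbour, and one
        exists because \<open>\<sigma>\<close> is nonempty and contains only such vertices.\<close>
      case True
      then show ?thesis using R sub by (auto simp: common_nbh_def)
    next
      case False
      obtain c where c: "\<forall>v. (v, b) \<in> \<sigma> \<longrightarrow> (v, c) \<in> parcs H" using R by blast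
      then have "c \<in> common_nbh (remove_isolated H) (side b \<sigma>)"
        using False arc by (fastforce simp: common_nbh_def side_def remove_isolated_def)
      then show ?thesis by blast
    qed
    have "(v, w) \<in> parcs H" if "(v, False) \<in> \<sigma>" "(w, True) \<in> \<sigma>" for v w
      using R that by (metis (full_types))
    then have "joined (remove_isolated H) (side False \<sigma>) (side True \<sigma>)"
      by (auto simp: joined_def side_def remove_isolated_def)
    then show ?L using R sub cn by (simp add: box_complex_def Let_def)
  qed
qed

lemma box_complexD:
  assumes "pair_pseudo_graph H" "\<sigma> \<in> box_complex H"
  shows "\<sigma> \<noteq> {}" "(v, b) \<in> \<sigma> \<Longrightarrow> (w, \<not> b) \<in> \<sigma> \<Longrightarrow> (v, w) \<in> parcs H"
    "\<exists>c. \<forall>v. (v, b) \<in> \<sigma> \<longrightarrow> (v, c) \<in> parcs H"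
  using assms(2) unfolding box_complex_iff[OF assms(1)] by blast+

lemma box_complexI:
  assumes "pair_pseudo_graph H" "\<sigma> \<noteq> {}"
    "\<And>v w b. (v, b) \<in> \<sigma> \<Longrightarrow> (w, \<not> b) \<in> \<sigma> \<Longrightarrow> (v, w) \<in> parcs H"
    "\<And>b. \<exists>c. \<forall>v. (v, b) \<in> \<sigma> \<longrightarrow> (v, c) \<in> parcs H"
  shows "\<sigma> \<in> box_complex H"
  unfolding box_complex_iff[OF assms(1)] using assms(2-4) by blast

lemma box_complex_subset:
  assumes "pair_pseudo_graph H" "\<sigma> \<in> box_complex H" "\<tau> \<subseteq> \<sigma>" "\<tau> \<noteq> {}"
  shows "\<tau> \<in> box_complex H"
proof (rule box_complexI[OF assms(1,4)])
  show "(v, w) \<in> parcs H" if "(v, b) \<in> \<tau>" "(w, \<not> b) \<in> \<tau>" for v w b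
    using box_complexD(2)[OF assms(1,2)] that assms(3) by blast
  show "\<exists>c. \<forall>v. (v, b) \<in> \<tau> \<longrightarrow> (v, c) \<in> parcs H" for b
    using box_complexD(3)[OF assms(1,2), of b] assms(3) by blast
qed

section \<open>Points of the box complex as weight functions\<close>

definition box_points :: "'a pair_pre_digraph \<Rightarrow> ('a \<times> bool \<Rightarrow> real) set" where
  "box_points H = underlying (box_complex H)"

definition flip :: "('a \<times> bool \<Rightarrow> real) \<Rightarrow> ('a \<times> bool \<Rightarrow> real)" where
  "flip x = (\<lambda>(v, b). x (v, \<not> b))"

lemma flip_apply [simp]: "flip x (v, b) = x (v, \<not> b)"
  by (simp add: flip_def)

lemma box_points_iff:
  assumes "pair_pseudo_graph H"
  shows "x \<in> box_points H \<longleftrightarrow>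
    (\<forall>u. 0 \<le> x u) \<and> {u. x u \<noteq> 0} \<in> box_complex H \<and> sum x (\<Union>(box_complex H)) = 1"
proof
  have fin: "finite \<sigma>" if "\<sigma> \<in> box_complex H" for \<sigma>
    by (rule finite_subset[OF _ finite_Union_box_complex[OF assms]]) (use that in blast)
  assume "x \<in> box_points H"
  then obtain \<sigma> where \<sigma>: "\<sigma> \<in> box_complex H" "x \<in> geom_simplex \<sigma>"
    by (auto simp: box_points_def underlying_def)
  then have x: "\<forall>u. 0 \<le> x u" "\<forall>u. u \<notin> \<sigma> \<longrightarrow> x u = 0" "sum x \<sigma> = 1"
    by (simp_all add: geom_simplex_iff[OF fin])
  have "sum x (\<Union>(box_complex H)) = sum x \<sigma>"
    by (rule sum.mono_neutral_right) (use \<sigma> x finite_Union_box_complex[OF assms] in auto)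
  moreover have "{u. x u \<noteq> 0} \<in> box_complex H"
  proof (rule box_complex_subset[OF assms \<sigma>(1)])
    show "{u. x u \<noteq> 0} \<noteq> {}"
      using x(3) by (metis (mono_tags, lifting) empty_iff mem_Collect_eq sum.neutral zero_neq_one)
  qed (use x in auto)
  ultimately show "(\<forall>u. 0 \<le> x u) \<and> {u. x u \<noteq> 0} \<in> box_complex H \<and> sum x (\<Union>(box_complex H)) = 1"
    using x by simp
next
  have fin: "finite \<sigma>" if "\<sigma> \<in> box_complex H" for \<sigma>
    by (rule finite_subset[OF _ finite_Union_box_complex[OF assms]]) (use that in blast)
  assume R: "(\<forall>u. 0 \<le> x u) \<and> {u. x u \<noteq> 0} \<in> box_complex H \<and> sum x (\<Union>(box_complex H)) = 1"
  then have "sum x {u. x u \<noteq> 0} = sum x (\<Union>(box_complex H))"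
    by (intro sum.mono_neutral_left) (use finite_Union_box_complex[OF assms] in auto)
  then have "x \<in> geom_simplex {u. x u \<noteq> 0}"
    using R by (subst geom_simplex_iff) (auto intro: fin)
  then show "x \<in> box_points H"
    using R by (auto simp: box_points_def underlying_def)
qed

lemma sum_flip:
  assumes "pair_pseudo_graph H"
  shows "sum (flip x) (\<Union>(box_complex H)) = sum x (\<Union>(box_complex H))"
  unfolding Union_box_complex[OF assms]
  by (rule sum.reindex_bij_witness[where i = "\<lambda>(v, b). (v, \<not> b)" and j = "\<lambda>(v, b). (v, \<not> b)"]) auto

lemma linear_ext_flip:
  assumes "pair_pseudo_graph H" "x \<in> box_points H"
  shows "linear_ext (\<Union>(box_complex H)) (\<lambda>(v, b). (v, \<not> b)) x = flip x"
proof
  fix w :: "'a \<times> bool"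
  let ?V = "\<Union>(box_complex H)"
  obtain v b where w: "w = (v, b)" by force
  have "linear_ext ?V (\<lambda>(v, b). (v, \<not> b)) x w = (\<Sum>u\<in>?V. if u = (v, \<not> b) then x u else 0)"
    unfolding linear_ext_def w by (rule sum.cong) (auto simp: basis_vec_def split: prod.splits)
  also have "\<dots> = (if (v, \<not> b) \<in> ?V then x (v, \<not> b) else 0)"
    using finite_Union_box_complex[OF assms(1)] by (rule sum.delta)
  also have "\<dots> = flip x w"
    using assms(2) unfolding box_points_iff[OF assms(1)] w by auto
  finally show "linear_ext ?V (\<lambda>(v, b). (v, \<not> b)) x w = flip x w" .
qed

lemma fst_box_space:
  assumes "pair_pseudo_graph H"
  shows "fst (box_space H) = top_of_set (box_points H)"
  by (simp add: box_space_def box_real_def box_points_def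
      mtopology_of_realization[OF finite_Union_box_complex[OF assms]])

lemma snd_box_space:
  assumes "pair_pseudo_graph H" "x \<in> box_points H"
  shows "snd (box_space H) x = flip x"
  by (simp add: box_space_def linear_ext_flip[OF assms])

lemma equivariant_box_iff:
  assumes "pair_pseudo_graph H" "pair_pseudo_graph H'" "\<And>x. x \<in> box_points H \<Longrightarrow> f x \<in> box_points H'"
  shows "equivariant (box_space H) (box_space H') f \<longleftrightarrow> (\<forall>x\<in>box_points H. f (flip x) = flip (f x))"
  using assms by (simp add: equivariant_def fst_box_space snd_box_space)

lemma Z2_map_box_iff:
  assumes "pair_pseudo_graph H" "pair_pseudo_graph H'"
  shows "Z2_map (box_space H) (box_space H') f \<longleftrightarrow> continuous_on (box_points H) f \<and>
    (\<forall>x\<in>box_points H. f x \<in> box_points H') \<and> (\<forall>x\<in>box_points H. f (flip x) = flip (f x))"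
  unfolding Z2_map_def fst_box_space[OF assms(1)] fst_box_space[OF assms(2)]
  using equivariant_box_iff[OF assms, of f] by auto

text \<open>Convexity: the segment from \<open>f x\<close> to \<open>g x\<close> stays in the common
  simplex, and flipping is linear, so every stage is equivariant. This reduces a homotopy to a
  statement about supports.\<close>

lemma Z2_homotopic_linear:
  assumes H: "pair_pseudo_graph H" and H': "pair_pseudo_graph H'"
    and f: "Z2_map (box_space H) (box_space H') f" and g: "Z2_map (box_space H) (box_space H') g"
    and common: "\<And>x. x \<in> box_points H \<Longrightarrow> \<exists>\<sigma>\<in>box_complex H'. {u. f x u \<noteq> 0} \<union> {u. g x u \<noteq> 0} \<subseteq> \<sigma>"
  shows "Z2_homotopic (box_space H) (box_space H') f g"
proof -
  define h where "h = (\<lambda>(t::real, x) u. (1 - t) * f x u + t * g x u)"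
  note f' = f[unfolded Z2_map_box_iff[OF H H']] and g' = g[unfolded Z2_map_box_iff[OF H H']]
  have pts: "h (t, x) \<in> box_points H'" if t: "t \<in> {0..1}" and x: "x \<in> box_points H" for t x
  proof -
    have fx: "\<And>u. 0 \<le> f x u" "sum (f x) (\<Union>(box_complex H')) = 1"
      and gx: "\<And>u. 0 \<le> g x u" "sum (g x) (\<Union>(box_complex H')) = 1"
      using f' g' x box_points_iff[OF H'] by blast+
    obtain \<sigma> where \<sigma>: "\<sigma> \<in> box_complex H'" "{u. f x u \<noteq> 0} \<union> {u. g x u \<noteq> 0} \<subseteq> \<sigma>"
      using common[OF x] by blast
    have s: "sum (h (t, x)) (\<Union>(box_complex H')) = 1"
      using fx gx by (simp add: h_def sum.distrib sum_distrib_left[symmetric])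
    have "{u. h (t, x) u \<noteq> 0} \<in> box_complex H'"
    proof (rule box_complex_subset[OF H' \<sigma>(1)])
      show "{u. h (t, x) u \<noteq> 0} \<subseteq> \<sigma>"
      proof
        fix u assume "u \<in> {u. h (t, x) u \<noteq> 0}"
        then have "f x u \<noteq> 0 \<or> g x u \<noteq> 0" by (auto simp: h_def)
        then show "u \<in> \<sigma>" using \<sigma>(2) by blast
      qed
      show "{u. h (t, x) u \<noteq> 0} \<noteq> {}"
        using s by (metis (mono_tags, lifting) empty_iff mem_Collect_eq sum.neutral zero_neq_one)
    qed
    moreover have "0 \<le> h (t, x) u" for u
      using fx gx t by (simp add: h_def)
    ultimately show ?thesis
      using s by (simp add: box_points_iff[OF H'])
  qed
  have "continuous_on ({0..1} \<times> box_points H) h"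
  proof (rule continuous_on_coordinatewise_then_product)
    fix u
    have "continuous_on (box_points H) (\<lambda>x. f x u)" "continuous_on (box_points H) (\<lambda>x. g x u)"
      by (rule continuous_on_product_then_coordinatewise, use f' g' in blast)+
    moreover have "continuous_on ({0..1::real} \<times> box_points H) (\<lambda>z. p (snd z))"
      if "continuous_on (box_points H) p" for p :: "('a \<times> bool \<Rightarrow> real) \<Rightarrow> real"
      using continuous_on_compose2[OF that continuous_on_snd[OF continuous_on_id],
          of "{0..1::real} \<times> box_points H"] by auto
    ultimately have "continuous_on ({0..1::real} \<times> box_points H) (\<lambda>z. f (snd z) u)"
      "continuous_on ({0..1::real} \<times> box_points H) (\<lambda>z. g (snd z) u)"
      by blast+
    then show "continuous_on ({0..1} \<times> box_points H) (\<lambda>z. h z u)"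
      unfolding h_def case_prod_beta by (intro continuous_intros)
  qed
  moreover have "equivariant (box_space H) (box_space H') (\<lambda>x. h (t, x))" if "t \<in> {0..1}" for t
  proof (subst equivariant_box_iff[OF H H'])
    show "\<forall>x\<in>box_points H. h (t, flip x) = flip (h (t, x))"
      using f' g' by (simp add: h_def fun_eq_iff)
  qed (use pts that in blast)
  moreover have "h \<in> {0..1} \<times> box_points H \<rightarrow> box_points H'"
    using pts by auto
  moreover have "h (0, x) = f x" "h (1, x) = g x" for x
    by (simp_all add: h_def)
  ultimately show ?thesis
    unfolding Z2_homotopic_def homotopic_with_def fst_box_space[OF H] fst_box_space[OF H']
      prod_topology_subtopology_eu continuous_map_subtopology_eu by blast
qed

definition normalized :: "'b pair_pre_digraph \<Rightarrow> ('b \<times> bool \<Rightarrow> real) \<Rightarrow> ('b \<times> bool \<Rightarrow> real)" where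
  "normalized H y = (\<lambda>u. y u / sum y (\<Union>(box_complex H)))"

lemma normalized_box_points:
  assumes H: "pair_pseudo_graph H" and nn: "\<And>u. 0 \<le> y u" and s: "{u. y u \<noteq> 0} \<in> box_complex H"
  shows "sum y (\<Union>(box_complex H)) > 0" "normalized H y \<in> box_points H"
    "{u. normalized H y u \<noteq> 0} = {u. y u \<noteq> 0}"
proof -
  let ?V = "\<Union>(box_complex H)"
  obtain u where u: "y u \<noteq> 0"
    using box_complexD(1)[OF H s] by blast
  then have "0 < y u" "u \<in> ?V"
    using nn[of u] s by auto
  then show pos: "sum y ?V > 0"
    using finite_Union_box_complex[OF H] nn by (intro sum_pos2[of _ u]) auto
  then show eq: "{u. normalized H y u \<noteq> 0} = {u. y u \<noteq> 0}"
    by (auto simp: normalized_def)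
  show "normalized H y \<in> box_points H"
    unfolding box_points_iff[OF H] eq
    using pos nn s by (auto simp: normalized_def sum_divide_distrib[symmetric] less_imp_le)
qed

text \<open>Lets maps be built from unnormalised weights: the support is a simplex, hence nonempty,
  so the total weight by which one divides is positive, and flipping preserves it.\<close>

lemma Z2_map_normalized:
  assumes H: "pair_pseudo_graph H" and H': "pair_pseudo_graph H'"
    and cont: "\<And>u. continuous_on (box_points H) (\<lambda>x. c x u)"
    and nn: "\<And>x u. x \<in> box_points H \<Longrightarrow> 0 \<le> c x u"
    and s: "\<And>x. x \<in> box_points H \<Longrightarrow> {u. c x u \<noteq> 0} \<in> box_complex H'"
    and fl: "\<And>x. x \<in> box_points H \<Longrightarrow> c (flip x) = flip (c x)"
  shows "Z2_map (box_space H) (box_space H') (\<lambda>x. normalized H' (c x))"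
  unfolding Z2_map_box_iff[OF H H']
proof (intro conjI ballI)
  show "continuous_on (box_points H) (\<lambda>x. normalized H' (c x))"
  proof (rule continuous_on_coordinatewise_then_product)
    fix u
    have "sum (c x) (\<Union>(box_complex H')) \<noteq> 0" if "x \<in> box_points H" for x
      using normalized_box_points(1)[OF H' nn[OF that] s[OF that]] by simp
    then show "continuous_on (box_points H) (\<lambda>x. normalized H' (c x) u)"
      unfolding normalized_def using cont by (intro continuous_intros) auto
  qed
  fix x assume x: "x \<in> box_points H"
  show "normalized H' (c x) \<in> box_points H'"
    by (rule normalized_box_points(2)[OF H' nn[OF x] s[OF x]])
  show "normalized H' (c (flip x)) = flip (normalized H' (c x))"
    by (auto simp: fun_eq_iff normalized_def fl[OF x] sum_flip[OF H'])
qed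

section \<open>Calculus of equivariant homotopies\<close>

lemma Z2_map_comp:
  assumes "Z2_map X Y f" "Z2_map Y Z g"
  shows "Z2_map X Z (g \<circ> f)"
  using assms by (auto simp: Z2_map_def equivariant_def intro: continuous_map_compose
      dest: continuous_map_image_subset_topspace)

lemma Z2_homotopic_comp_left:
  assumes "Z2_homotopic X Y f g" "Z2_map Y Z h"
  shows "Z2_homotopic X Z (h \<circ> f) (h \<circ> g)"
proof -
  \<comment> \<open>Continuity joins the property so that intermediate maps are known to land in the
    space of \<open>Y\<close>, where alone \<open>h\<close> is equivariant.\<close>
  have "homotopic_with (\<lambda>f. continuous_map (fst X) (fst Y) f \<and> equivariant X Y f) (fst X) (fst Y) f g"
    using assms(1) unfolding Z2_homotopic_def by (rule homotopic_with_mono) simp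
  then show ?thesis
    unfolding Z2_homotopic_def
    by (rule homotopic_with_compose_continuous_map_left)
      (use assms(2) in \<open>auto simp: Z2_map_def equivariant_def continuous_map_def\<close>)
qed

lemma Z2_homotopic_comp_right:
  assumes "Z2_homotopic Y Z f g" "Z2_map X Y h"
  shows "Z2_homotopic X Z (f \<circ> h) (g \<circ> h)"
  using assms(1) unfolding Z2_homotopic_def
  by (rule homotopic_with_compose_continuous_map_right)
    (use assms(2) in \<open>auto simp: Z2_map_def equivariant_def continuous_map_def\<close>)

lemma Z2_homotopic_trans:
  "Z2_homotopic X Y f g \<Longrightarrow> Z2_homotopic X Y g h \<Longrightarrow> Z2_homotopic X Y f h"
  unfolding Z2_homotopic_def by (rule homotopic_with_trans)

lemma Z2_homotopic_imp_Z2_map: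
  "Z2_homotopic X Y f g \<Longrightarrow> Z2_map X Y f" "Z2_homotopic X Y f g \<Longrightarrow> Z2_map X Y g"
  unfolding Z2_homotopic_def Z2_map_def
  using homotopic_with_imp_continuous_maps homotopic_with_imp_property by blast+

lemma Z2_homotopy_equivalence_homotopic:
  assumes "Z2_homotopy_equivalence X Y f" "Z2_homotopic X Y g f"
  shows "Z2_homotopy_equivalence X Y g"
proof -
  obtain f' where f': "Z2_map Y X f'" "Z2_homotopic X X (f' \<circ> f) id" "Z2_homotopic Y Y (f \<circ> f') id"
    using assms(1) by (auto simp: Z2_homotopy_equivalence_def)
  have "Z2_homotopic X X (f' \<circ> g) id"
    using Z2_homotopic_trans Z2_homotopic_comp_left[OF assms(2) f'(1)] f'(2) by blast
  moreover have "Z2_homotopic Y Y (g \<circ> f') id"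
    using Z2_homotopic_trans Z2_homotopic_comp_right[OF assms(2) f'(1)] f'(3) by blast
  ultimately show ?thesis
    using f'(1) Z2_homotopic_imp_Z2_map(1)[OF assms(2)] by (auto simp: Z2_homotopy_equivalence_def)
qed

lemma Z2_homotopy_equivalence_comp:
  assumes "Z2_homotopy_equivalence X Y f" "Z2_homotopy_equivalence Y Z g"
  shows "Z2_homotopy_equivalence X Z (g \<circ> f)"
proof -
  obtain f' where f: "Z2_map X Y f" and f': "Z2_map Y X f'"
    "Z2_homotopic X X (f' \<circ> f) id" "Z2_homotopic Y Y (f \<circ> f') id"
    using assms(1) by (auto simp: Z2_homotopy_equivalence_def)
  obtain g' where g: "Z2_map Y Z g" and g': "Z2_map Z Y g'"
    "Z2_homotopic Y Y (g' \<circ> g) id" "Z2_homotopic Z Z (g \<circ> g') id"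
    using assms(2) by (auto simp: Z2_homotopy_equivalence_def)
  have "Z2_homotopic X X (f' \<circ> (g' \<circ> g) \<circ> f) (f' \<circ> id \<circ> f)"
    using g'(2) f f'(1) by (intro Z2_homotopic_comp_left Z2_homotopic_comp_right)
  then have 1: "Z2_homotopic X X ((f' \<circ> g') \<circ> (g \<circ> f)) id"
    using f'(2) by (auto simp: o_assoc intro: Z2_homotopic_trans)
  have "Z2_homotopic Z Z (g \<circ> (f \<circ> f') \<circ> g') (g \<circ> id \<circ> g')"
    using f'(3) g g'(1) by (intro Z2_homotopic_comp_left Z2_homotopic_comp_right)
  then have "Z2_homotopic Z Z ((g \<circ> f) \<circ> (f' \<circ> g')) id"
    using g'(3) by (auto simp: o_assoc intro: Z2_homotopic_trans)
  with 1 show ?thesis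
    using Z2_map_comp[OF f g] Z2_map_comp[OF g'(1) f'(1)] unfolding Z2_homotopy_equivalence_def by blast
qed

section \<open>Maps induced by homomorphisms\<close>

text \<open>Nonnegative coefficients cannot cancel, so supports are mapped onto supports.\<close>

lemma linear_ext_nonzero_iff:
  assumes "finite V" "\<And>u. 0 \<le> x u" "\<And>u. x u \<noteq> 0 \<Longrightarrow> u \<in> V"
  shows "linear_ext V f x w \<noteq> 0 \<longleftrightarrow> (\<exists>u. x u \<noteq> 0 \<and> f u = w)"
proof -
  have "linear_ext V f x w = 0 \<longleftrightarrow> (\<forall>u\<in>V. x u * basis_vec (f u) w = 0)"
    unfolding linear_ext_def by (rule sum_nonneg_eq_0_iff) (use assms in \<open>auto simp: basis_vec_def\<close>)
  then show ?thesis
    using assms(3) by (auto simp: basis_vec_def)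
qed

lemma box_map_nonzero:
  assumes H: "pair_pseudo_graph H" and x: "x \<in> box_points H"
  shows "box_map H h x (w, b) \<noteq> 0 \<longleftrightarrow> (\<exists>v. x (v, b) \<noteq> 0 \<and> h v = w)"
  unfolding box_map_def using x unfolding box_points_iff[OF H]
  by (subst linear_ext_nonzero_iff[OF finite_Union_box_complex[OF H]]) auto

lemma box_complex_hom_image:
  assumes H: "pair_pseudo_graph H" and H': "pair_pseudo_graph H'"
    and hom: "\<And>v w. (v, w) \<in> parcs H \<Longrightarrow> (h v, h w) \<in> parcs H'"
    and s: "\<sigma> \<in> box_complex H"
  shows "(\<lambda>(v, b). (h v, b)) ` \<sigma> \<in> box_complex H'"
proof (rule box_complexI[OF H'])
  show "(\<lambda>(v, b). (h v, b)) ` \<sigma> \<noteq> {}"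
    using box_complexD(1)[OF H s] by simp
  show "(v', w') \<in> parcs H'"
    if v': "(v', b) \<in> (\<lambda>(v, b). (h v, b)) ` \<sigma>" and w': "(w', \<not> b) \<in> (\<lambda>(v, b). (h v, b)) ` \<sigma>" for v' w' b
  proof -
    obtain v where "(v, b) \<in> \<sigma>" "v' = h v" using v' by auto
    moreover obtain w where "(w, \<not> b) \<in> \<sigma>" "w' = h w" using w' by auto
    ultimately show ?thesis using box_complexD(2)[OF H s] hom by blast
  qed
  show "\<exists>c. \<forall>v'. (v', b) \<in> (\<lambda>(v, b). (h v, b)) ` \<sigma> \<longrightarrow> (v', c) \<in> parcs H'" for b
  proof -
    obtain c where "\<forall>v. (v, b) \<in> \<sigma> \<longrightarrow> (v, c) \<in> parcs H"
      using box_complexD(3)[OF H s] by blast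
    then show ?thesis by (intro exI[of _ "h c"]) (auto intro: hom)
  qed
qed

lemma hom_Union_box_complex:
  assumes "pair_pseudo_graph H" "pair_pseudo_graph H'"
    "\<And>v w. (v, w) \<in> parcs H \<Longrightarrow> (h v, h w) \<in> parcs H'" "(v, b) \<in> \<Union>(box_complex H)"
  shows "(h v, b) \<in> \<Union>(box_complex H')"
proof -
  obtain \<sigma> where "\<sigma> \<in> box_complex H" "(v, b) \<in> \<sigma>" using assms(4) by blast
  then have "(\<lambda>(v, b). (h v, b)) ` \<sigma> \<in> box_complex H'" "(h v, b) \<in> (\<lambda>(v, b). (h v, b)) ` \<sigma>"
    using box_complex_hom_image[where h = h, OF assms(1-3)] by force+
  then show ?thesis by blast
qed

lemma Z2_map_box_map:
  assumes H: "pair_pseudo_graph H" and H': "pair_pseudo_graph H'"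
    and hom: "\<And>v w. (v, w) \<in> parcs H \<Longrightarrow> (h v, h w) \<in> parcs H'"
  shows "Z2_map (box_space H) (box_space H') (box_map H h)"
  unfolding Z2_map_box_iff[OF H H']
proof (intro conjI ballI)
  let ?V = "\<Union>(box_complex H)" and ?V' = "\<Union>(box_complex H')"
  show "continuous_on (box_points H) (box_map H h)"
    unfolding box_map_def linear_ext_def
    by (intro continuous_on_coordinatewise_then_product continuous_intros
        continuous_on_subset[OF continuous_on_product_coordinates]) auto
  fix x assume x: "x \<in> box_points H"
  then have x': "\<And>u. 0 \<le> x u" "{u. x u \<noteq> 0} \<in> box_complex H" "sum x ?V = 1"
    unfolding box_points_iff[OF H] by auto
  have eq: "{u. box_map H h x u \<noteq> 0} = (\<lambda>(v, b). (h v, b)) ` {u. x u \<noteq> 0}"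
    using box_map_nonzero[OF H x, of h] by force
  have "sum (box_map H h x) ?V' = (\<Sum>u\<in>?V. \<Sum>w\<in>?V'. x u * basis_vec ((\<lambda>(v, b). (h v, b)) u) w)"
    unfolding box_map_def linear_ext_def by (rule sum.swap)
  also have "\<dots> = sum x ?V"
  proof (rule sum.cong[OF refl])
    fix u assume u: "u \<in> ?V"
    obtain v b where vb: "u = (v, b)" by force
    have "(\<Sum>w\<in>?V'. x u * basis_vec ((\<lambda>(v, b). (h v, b)) u) w) = (\<Sum>w\<in>?V'. if w = (h v, b) then x u else 0)"
      by (intro sum.cong) (auto simp: basis_vec_def vb)
    also have "\<dots> = x u"
      using hom_Union_box_complex[where h = h, OF H H' hom] u finite_Union_box_complex[OF H']
      by (simp add: vb)
    finally show "(\<Sum>w\<in>?V'. x u * basis_vec ((\<lambda>(v, b). (h v, b)) u) w) = x u" .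
  qed
  finally have "sum (box_map H h x) ?V' = 1" using x' by simp
  moreover have "0 \<le> box_map H h x u" for u
    unfolding box_map_def linear_ext_def using x' by (auto intro!: sum_nonneg simp: basis_vec_def)
  ultimately show "box_map H h x \<in> box_points H'"
    unfolding box_points_iff[OF H'] eq using box_complex_hom_image[where h = h, OF H H' hom x'(2)] by auto
  show "box_map H h (flip x) = flip (box_map H h x)"
  proof
    fix w :: "'b \<times> bool"
    obtain v b where w: "w = (v, b)" by force
    show "box_map H h (flip x) w = flip (box_map H h x) w"
      unfolding box_map_def linear_ext_def w flip_apply unfolding Union_box_complex[OF H]
      by (rule sum.reindex_bij_witness[where i = "\<lambda>(v, b). (v, \<not> b)" and j = "\<lambda>(v, b). (v, \<not> b)"])
        (auto simp: basis_vec_def)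
  qed
qed

text \<open>Serves to compose the projections that drop single coordinates. Since \<open>h\<close>
  preserves arcs, each \<open>(h v, b)\<close> is a vertex of the second complex, and the inner sum
  picks out exactly one term.\<close>

lemma box_map_comp:
  assumes H: "pair_pseudo_graph H" and H': "pair_pseudo_graph H'"
    and hom: "\<And>v w. (v, w) \<in> parcs H \<Longrightarrow> (h v, h w) \<in> parcs H'"
  shows "box_map H' f (box_map H h x) = box_map H (\<lambda>v. f (h v)) x"
proof
  fix z
  let ?V = "\<Union>(box_complex H)" and ?V' = "\<Union>(box_complex H')"
  let ?h = "\<lambda>(v, b). (h v, b)" and ?f = "\<lambda>(v, b). (f v, b)"
  have "box_map H' f (box_map H h x) z = (\<Sum>w\<in>?V'. \<Sum>u\<in>?V. x u * basis_vec (?h u) w * basis_vec (?f w) z)"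
    unfolding box_map_def linear_ext_def by (simp add: sum_distrib_right)
  also have "\<dots> = (\<Sum>u\<in>?V. \<Sum>w\<in>?V'. x u * basis_vec (?h u) w * basis_vec (?f w) z)"
    by (rule sum.swap)
  also have "\<dots> = (\<Sum>u\<in>?V. x u * basis_vec ((\<lambda>(v, b). (f (h v), b)) u) z)"
  proof (rule sum.cong[OF refl])
    fix u assume u: "u \<in> ?V"
    obtain v b where vb: "u = (v, b)" by force
    have "(\<Sum>w\<in>?V'. x u * basis_vec (?h u) w * basis_vec (?f w) z)
        = (\<Sum>w\<in>?V'. if w = (h v, b) then x u * basis_vec (f (h v), b) z else 0)"
      by (intro sum.cong) (auto simp: basis_vec_def vb)
    also have "\<dots> = x u * basis_vec ((\<lambda>(v, b). (f (h v), b)) u) z"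
      using hom_Union_box_complex[where h = h, OF H H' hom] u finite_Union_box_complex[OF H']
      by (simp add: vb)
    finally show "(\<Sum>w\<in>?V'. x u * basis_vec (?h u) w * basis_vec (?f w) z)
        = x u * basis_vec ((\<lambda>(v, b). (f (h v), b)) u) z" .
  qed
  also have "\<dots> = box_map H (\<lambda>v. f (h v)) x z"
    by (simp add: box_map_def linear_ext_def)
  finally show "box_map H' f (box_map H h x) z = box_map H (\<lambda>v. f (h v)) x z" .
qed

section \<open>A criterion for homotopy equivalence\<close>

text \<open>The vertex \<open>\<ll> v T\<close> over \<open>v\<close> is meant to be adjacent to as many vertices over \<open>T\<close> as possible.\<close>

locale lifting =
  fixes H :: "'a pair_pre_digraph" and H' :: "'b pair_pre_digraph"
    and \<pi> :: "'b \<Rightarrow> 'a" and \<ll> :: "'a \<Rightarrow> 'a set \<Rightarrow> 'b"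
  assumes H: "pair_pseudo_graph H" and H': "pair_pseudo_graph H'"
    and hom: "\<And>A B. (A, B) \<in> parcs H' \<Longrightarrow> (\<pi> A, \<pi> B) \<in> parcs H"
    and proj_lift [simp]: "\<And>v T. \<pi> (\<ll> v T) = v"
    and lift_lift: "\<And>S T v w. joined H S T \<Longrightarrow> v \<in> S \<Longrightarrow> w \<in> T \<Longrightarrow> (\<ll> v T, \<ll> w S) \<in> parcs H'"
    and lift_arc: "\<And>A B T. (A, B) \<in> parcs H' \<Longrightarrow> \<pi> B \<in> T \<Longrightarrow>
      (\<And>w. w \<in> T \<Longrightarrow> \<exists>B'. (A, B') \<in> parcs H' \<and> \<pi> B' = w) \<Longrightarrow> (\<ll> (\<pi> A) T, B) \<in> parcs H'"
begin

text \<open>Some coordinate of a point is at least \<open>1 / card (\<Union>(box_complex H))\<close>, so after stretching it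
  exceeds the highest threshold \<open>2\<close>.\<close>

definition stretch :: real where
  "stretch = 3 * card (\<Union>(box_complex H))"

text \<open>Occurs with \<open>j\<close> equal to 0, 1 and 2, whose windows of growth are
  consecutive: a stretched value above 2 has saturated \<open>ramp 1\<close> and
  \<open>ramp 0\<close>, and one above 1 has saturated \<open>ramp 0\<close>.\<close>

definition ramp :: "real \<Rightarrow> real \<Rightarrow> real" where
  "ramp j t = max 0 (min 1 (stretch * t - j))"

lemma ramp_bounds [simp]: "0 \<le> ramp j t" "ramp j t \<le> 1"
  by (auto simp: ramp_def)

lemma ramp_eq_0_iff: "ramp j t = 0 \<longleftrightarrow> stretch * t \<le> j"
  by (auto simp: ramp_def)

lemma ramp_eq_1_iff: "ramp j t = 1 \<longleftrightarrow> j + 1 \<le> stretch * t"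
  by (auto simp: ramp_def)

lemma continuous_on_ramp [continuous_intros]:
  "continuous_on X f \<Longrightarrow> continuous_on X (\<lambda>x. ramp j (f x))"
  unfolding ramp_def by (intro continuous_intros)

definition slice :: "bool \<Rightarrow> ('a \<times> bool \<Rightarrow> real) \<Rightarrow> 'a \<Rightarrow> real" where
  "slice b x = (\<lambda>v. x (v, b))"

definition faint :: "('a \<Rightarrow> real) \<Rightarrow> real" where
  "faint \<xi> = (\<Prod>v\<in>pverts H. 1 - ramp 1 (\<xi> v))"

text \<open>The probability of \<open>T\<close> when each vertex \<open>v\<close> is selected
  independently with probability \<open>ramp 0 (\<xi> v)\<close>; likewise \<open>faint\<close> is
  the probability that nothing is selected under \<open>ramp 1\<close>. The sets that can occur lie
  between two superlevel sets of \<open>\<xi>\<close>.\<close>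

definition layer :: "('a \<Rightarrow> real) \<Rightarrow> 'a set \<Rightarrow> real" where
  "layer \<xi> T = (\<Prod>v\<in>pverts H. if v \<in> T then ramp 0 (\<xi> v) else 1 - ramp 0 (\<xi> v))"

lemma finite_pverts: "finite (pverts H)"
proof -
  interpret pair_pseudo_graph H by (rule H)
  show ?thesis by (rule pair_finite_verts)
qed

lemma arcs_pverts: "(v, w) \<in> parcs H \<Longrightarrow> v \<in> pverts H" "(v, w) \<in> parcs H \<Longrightarrow> w \<in> pverts H"
proof -
  interpret pair_pseudo_graph H by (rule H)
  show "(v, w) \<in> parcs H \<Longrightarrow> v \<in> pverts H" "(v, w) \<in> parcs H \<Longrightarrow> w \<in> pverts H"
    by (blast intro: in_arcsD1 in_arcsD2)+
qed

lemma arc_sym: "(A, B) \<in> parcs H' \<Longrightarrow> (B, A) \<in> parcs H'"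
proof -
  interpret pair_pseudo_graph H' by (rule H')
  show "(A, B) \<in> parcs H' \<Longrightarrow> (B, A) \<in> parcs H'" by (rule arcs_symmetric)
qed

lemma faint_bounds: "0 \<le> faint \<xi>" "faint \<xi> \<le> 1"
  by (auto simp: faint_def intro!: prod_nonneg prod_le_1)

lemma faint_nonzero: "faint \<xi> \<noteq> 0 \<Longrightarrow> v \<in> pverts H \<Longrightarrow> stretch * \<xi> v < 2"
  using finite_pverts ramp_eq_1_iff[of 1 "\<xi> v"] by (auto simp: faint_def)

lemma faint_not_one: "faint \<xi> \<noteq> 1 \<Longrightarrow> \<exists>v\<in>pverts H. 1 < stretch * \<xi> v"
proof (rule ccontr)
  assume "faint \<xi> \<noteq> 1" "\<not> (\<exists>v\<in>pverts H. 1 < stretch * \<xi> v)"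
  then have "ramp 1 (\<xi> v) = 0" if "v \<in> pverts H" for v
    using that by (simp add: ramp_eq_0_iff not_less)
  then have "faint \<xi> = 1" unfolding faint_def by simp
  then show False using \<open>faint \<xi> \<noteq> 1\<close> by simp
qed

lemma layer_nonneg: "0 \<le> layer \<xi> T"
  unfolding layer_def by (rule prod_nonneg) simp

lemma layer_nonzero:
  "layer \<xi> T \<noteq> 0 \<longleftrightarrow> (\<forall>v\<in>pverts H. if v \<in> T then 0 < stretch * \<xi> v else stretch * \<xi> v < 1)"
  using finite_pverts ramp_eq_1_iff[of 0] by (auto simp: layer_def ramp_eq_0_iff not_le)

lemma layer_nonzeroD:
  assumes "layer \<xi> T \<noteq> 0" "v \<in> pverts H"
  shows "v \<in> T \<Longrightarrow> \<xi> v \<noteq> 0" "1 \<le> stretch * \<xi> v \<Longrightarrow> v \<in> T"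
  using bspec[OF assms(1)[unfolded layer_nonzero] assms(2)] by (auto split: if_splits)

text \<open>The weight with which a vertex of the covering graph occurs on one side of the image of a
  point with slice \<open>\<xi>\<close> on this side and \<open>\<eta>\<close> on the other: a vertex \<open>v\<close> of large weight is lifted
  along a random superlevel set of \<open>\<eta>\<close>, or, when \<open>\<eta>\<close> is so small that these could be empty, along
  the common neighbourhood of a random superlevel set of \<open>\<xi>\<close>.\<close>

definition weight :: "('a \<Rightarrow> real) \<Rightarrow> ('a \<Rightarrow> real) \<Rightarrow> 'b \<Rightarrow> real" where
  "weight \<xi> \<eta> w = (\<Sum>v\<in>pverts H. \<Sum>T\<in>Pow (pverts H). ramp 2 (\<xi> v) *
      ((1 - faint \<eta>) * layer \<eta> T * of_bool (w = \<ll> v T) +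
       faint \<eta> * layer \<xi> T * of_bool (w = \<ll> v (common_nbh H T))))"

text \<open>The sets along which \<open>weight\<close> lifts high vertices; naming them frees the
  later arguments from the probabilities.\<close>

definition target :: "('a \<Rightarrow> real) \<Rightarrow> ('a \<Rightarrow> real) \<Rightarrow> 'a set \<Rightarrow> bool" where
  "target \<xi> \<eta> T \<longleftrightarrow> (\<exists>S\<subseteq>pverts H. (faint \<eta> \<noteq> 1 \<and> layer \<eta> S \<noteq> 0 \<and> T = S) \<or>
      (faint \<eta> \<noteq> 0 \<and> layer \<xi> S \<noteq> 0 \<and> T = common_nbh H S))"

lemma targetE:
  assumes "target \<xi> \<eta> T"
  obtains "T \<subseteq> pverts H" "faint \<eta> \<noteq> 1" "layer \<eta> T \<noteq> 0"
    | S where "S \<subseteq> pverts H" "faint \<eta> \<noteq> 0" "layer \<xi> S \<noteq> 0" "T = common_nbh H S"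
  using assms unfolding target_def by metis

definition high :: "('a \<Rightarrow> real) \<Rightarrow> 'a set" where
  "high \<xi> = {v \<in> pverts H. 2 < stretch * \<xi> v}"

lemma weight_nonneg: "0 \<le> weight \<xi> \<eta> w"
  unfolding weight_def
  by (intro sum_nonneg mult_nonneg_nonneg add_nonneg_nonneg) (simp_all add: faint_bounds layer_nonneg)

text \<open>All summands are nonnegative, so nothing cancels, and any vertex above the top window
  combines with any target.\<close>

lemma weight_nonzero: "weight \<xi> \<eta> w \<noteq> 0 \<longleftrightarrow> (\<exists>v\<in>high \<xi>. \<exists>T. target \<xi> \<eta> T \<and> w = \<ll> v T)"
proof -
  let ?t = "\<lambda>v T. ramp 2 (\<xi> v) * ((1 - faint \<eta>) * layer \<eta> T * of_bool (w = \<ll> v T) +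
       faint \<eta> * layer \<xi> T * of_bool (w = \<ll> v (common_nbh H T)))"
  have nn: "0 \<le> (1 - faint \<eta>) * layer \<eta> T * of_bool (w = \<ll> v T)"
    "0 \<le> faint \<eta> * layer \<xi> T * of_bool (w = \<ll> v (common_nbh H T))" for v T
    by (intro mult_nonneg_nonneg; simp add: faint_bounds layer_nonneg)+
  have t0: "0 \<le> ?t v T" for v T
    by (rule mult_nonneg_nonneg[OF ramp_bounds(1) add_nonneg_nonneg[OF nn]])
  have "weight \<xi> \<eta> w = 0 \<longleftrightarrow> (\<forall>v\<in>pverts H. (\<Sum>T\<in>Pow (pverts H). ?t v T) = 0)"
    unfolding weight_def by (intro sum_nonneg_eq_0_iff finite_pverts sum_nonneg t0)
  also have "\<dots> \<longleftrightarrow> (\<forall>v\<in>pverts H. \<forall>T\<in>Pow (pverts H). ?t v T = 0)"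
    using finite_pverts t0 by (intro ball_cong refl sum_nonneg_eq_0_iff) auto
  finally have 1: "weight \<xi> \<eta> w \<noteq> 0 \<longleftrightarrow> (\<exists>v\<in>pverts H. \<exists>T\<in>Pow (pverts H). ?t v T \<noteq> 0)"
    by blast
  have t: "?t v T \<noteq> 0 \<longleftrightarrow> 2 < stretch * \<xi> v \<and> ((faint \<eta> \<noteq> 1 \<and> layer \<eta> T \<noteq> 0 \<and> w = \<ll> v T) \<or>
      (faint \<eta> \<noteq> 0 \<and> layer \<xi> T \<noteq> 0 \<and> w = \<ll> v (common_nbh H T)))" for v T
    unfolding mult_eq_0_iff add_nonneg_eq_0_iff[OF nn] by (simp add: ramp_eq_0_iff not_le)
  show ?thesis
    unfolding 1 t
  proof
    assume "\<exists>v\<in>high \<xi>. \<exists>T. target \<xi> \<eta> T \<and> w = \<ll> v T"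
    then obtain v T where vT: "v \<in> pverts H" "2 < stretch * \<xi> v" "target \<xi> \<eta> T" "w = \<ll> v T"
      by (auto simp: high_def)
    from vT(3) obtain S where "S \<in> Pow (pverts H)" "(faint \<eta> \<noteq> 1 \<and> layer \<eta> S \<noteq> 0 \<and> T = S) \<or>
      (faint \<eta> \<noteq> 0 \<and> layer \<xi> S \<noteq> 0 \<and> T = common_nbh H S)"
      by (auto simp: target_def)
    then show "\<exists>v\<in>pverts H. \<exists>T\<in>Pow (pverts H). 2 < stretch * \<xi> v \<and>
        ((faint \<eta> \<noteq> 1 \<and> layer \<eta> T \<noteq> 0 \<and> w = \<ll> v T) \<or>
        (faint \<eta> \<noteq> 0 \<and> layer \<xi> T \<noteq> 0 \<and> w = \<ll> v (common_nbh H T)))"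
      using vT by (intro bexI[of _ v] bexI[of _ S]) auto
  qed (auto simp: high_def target_def)
qed

lemma target_exists: "\<exists>T. target \<xi> \<eta> T"
proof -
  \<comment> \<open>Selecting exactly the vertices where \<open>ramp 0\<close> equals 1 always has
    positive probability, and \<open>faint \<eta>\<close> cannot be both 0 and 1, so at least one of
    the two branches is active.\<close>
  have "layer \<zeta> {v \<in> pverts H. 1 \<le> stretch * \<zeta> v} \<noteq> 0" for \<zeta>
    by (auto simp: layer_nonzero)
  moreover have "{v \<in> pverts H. 1 \<le> stretch * \<zeta> v} \<subseteq> pverts H" for \<zeta> by blast
  ultimately show ?thesis
    unfolding target_def by (metis zero_neq_one)
qed

section \<open>Compatibility of targets with the simplices below\<close>

lemma point:
  assumes "x \<in> box_points H"
  shows "0 \<le> x u" "x (v, b) \<noteq> 0 \<Longrightarrow> x (w, \<not> b) \<noteq> 0 \<Longrightarrow> (v, w) \<in> parcs H"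
    "\<exists>c. \<forall>v. x (v, b) \<noteq> 0 \<longrightarrow> (v, c) \<in> parcs H"
proof -
  have nn: "\<forall>u. 0 \<le> x u" and s: "{u. x u \<noteq> 0} \<in> box_complex H"
    using assms unfolding box_points_iff[OF H] by blast+
  show "0 \<le> x u" using nn by blast
  show "(v, w) \<in> parcs H" if "x (v, b) \<noteq> 0" "x (w, \<not> b) \<noteq> 0"
    using box_complexD(2)[OF H s, of v b w] that by simp
  show "\<exists>c. \<forall>v. x (v, b) \<noteq> 0 \<longrightarrow> (v, c) \<in> parcs H"
    using box_complexD(3)[OF H s, of b] by simp
qed

lemma stretch_pos:
  assumes "x \<in> box_points H"
  shows "stretch > 0"
proof -
  have "sum x (\<Union>(box_complex H)) = 1" using assms by (simp add: box_points_iff[OF H])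
  then have "\<Union>(box_complex H) \<noteq> {}" by force
  then show ?thesis
    using finite_Union_box_complex[OF H] by (simp add: stretch_def card_gt_0_iff)
qed

lemma exists_high:
  assumes x: "x \<in> box_points H"
  shows "\<exists>b. high (slice b x) \<noteq> {}"
proof (rule ccontr)
  let ?V = "\<Union>(box_complex H)"
  assume neg: "\<not> ?thesis"
  have "stretch * x u \<le> 2" if "u \<in> ?V" for u
  proof -
    obtain v b where u: "u = (v, b)" by force
    then have "v \<in> pverts H" using that unfolding Union_box_complex[OF H] by auto
    then show ?thesis using neg by (auto simp: high_def slice_def u not_less)
  qed
  then have "(\<Sum>u\<in>?V. stretch * x u) \<le> (\<Sum>u\<in>?V. 2)" by (rule sum_mono)
  moreover have "(\<Sum>u\<in>?V. stretch * x u) = stretch"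
    using x by (simp add: sum_distrib_left[symmetric] box_points_iff[OF H])
  ultimately have "stretch \<le> 2 * card ?V" by simp
  then show False using stretch_pos[OF x] by (simp add: stretch_def)
qed

text \<open>A selected set of the other side lies in the support, which is joined to the side at
  hand. A common neighbourhood is taken of a set that contains every high vertex.\<close>

lemma joined_target:
  assumes x: "x \<in> box_points H" and T: "target (slice b x) (slice (\<not> b) x) T"
  shows "joined H (high (slice b x)) T"
  unfolding joined_def
proof (intro ballI)
  fix v w assume v: "v \<in> high (slice b x)" and w: "w \<in> T"
  have v0: "x (v, b) \<noteq> 0" using v by (auto simp: high_def slice_def)
  from T show "(v, w) \<in> parcs H"
  proof (cases rule: targetE)
    case 1
    then have "x (w, \<not> b) \<noteq> 0"
      using w layer_nonzeroD(1)[of "slice (\<not> b) x" T w] by (auto simp: slice_def)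
    then show ?thesis using point(2)[OF x v0] by blast
  next
    case (2 S)
    have "v \<in> S"
      using v layer_nonzeroD(2)[OF 2(3), of v] by (auto simp: high_def)
    then show ?thesis using 2(4) w by (auto simp: common_nbh_def)
  qed
qed

text \<open>A vertex above the top window on the other side makes \<open>faint\<close> vanish there.
  Only the selected sets remain as targets, and they contain all high vertices and consist of
  vertices actually present.\<close>

lemma target_both_high:
  assumes x: "x \<in> box_points H" and T: "target (slice b x) (slice (\<not> b) x) T"
    and w: "w \<in> high (slice (\<not> b) x)"
  shows "w \<in> T" "\<And>v. v \<in> T \<Longrightarrow> x (v, \<not> b) \<noteq> 0"
proof -
  have wv: "w \<in> pverts H" "2 < stretch * slice (\<not> b) x w"
    using w by (simp_all add: high_def)
  have "faint (slice (\<not> b) x) = 0"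
  proof (rule ccontr)
    assume "faint (slice (\<not> b) x) \<noteq> 0"
    from faint_nonzero[OF this wv(1)] wv(2) show False by linarith
  qed
  with T have S: "T \<subseteq> pverts H" "layer (slice (\<not> b) x) T \<noteq> 0"
    by (auto elim: targetE)
  then show "w \<in> T"
    using wv layer_nonzeroD(2)[OF S(2), of w] by linarith
  fix v assume "v \<in> T"
  then show "x (v, \<not> b) \<noteq> 0"
    using S(1) layer_nonzeroD(1)[OF S(2), of v] unfolding slice_def by blast
qed

text \<open>Provides the vertex over which a common neighbour of all lifts on side \<open>b\<close>
  is built: \<open>c\<close> if the other side has \<open>faint\<close> equal to 1, otherwise a
  vertex there above the lowest window. Every selected set contains the latter, and it is adjacent
  to everything present on side \<open>b\<close>.\<close>

lemma target_common:
  assumes x: "x \<in> box_points H" and c: "\<And>v. x (v, b) \<noteq> 0 \<Longrightarrow> (v, c) \<in> parcs H"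
    and v0: "x (v0, b) \<noteq> 0"
  shows "\<exists>w. (w = c \<or> x (w, \<not> b) \<noteq> 0) \<and> (\<forall>T. target (slice b x) (slice (\<not> b) x) T \<longrightarrow> w \<in> T)"
proof -
  have cn: "w \<in> common_nbh H S" if "layer (slice b x) S \<noteq> 0" "S \<subseteq> pverts H"
    "\<And>v. x (v, b) \<noteq> 0 \<Longrightarrow> (v, w) \<in> parcs H" for w S
    unfolding common_nbh_def
  proof (intro CollectI conjI ballI)
    show "w \<in> pverts H" using that(3)[OF v0] arcs_pverts by blast
    fix v assume "v \<in> S"
    then have "x (v, b) \<noteq> 0"
      using that(2) layer_nonzeroD(1)[OF that(1), of v] by (auto simp: slice_def)
    then show "(v, w) \<in> parcs H" by (rule that(3))
  qed
  show ?thesis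
  proof (cases "faint (slice (\<not> b) x) = 1")
    case True
    have "c \<in> T" if "target (slice b x) (slice (\<not> b) x) T" for T
      using that
    proof (cases rule: targetE)
      case (2 S)
      then show ?thesis using cn[OF _ _ c] by simp
    qed (use True in simp)
    then show ?thesis by blast
  next
    case False
    then obtain w where w: "w \<in> pverts H" "1 < stretch * x (w, \<not> b)"
      using faint_not_one by (auto simp: slice_def)
    have w0: "x (w, \<not> b) \<noteq> 0" using w by auto
    have "w \<in> T" if "target (slice b x) (slice (\<not> b) x) T" for T
      using that
    proof (cases rule: targetE)
      case 1
      then show ?thesis
        using w layer_nonzeroD(2)[of "slice (\<not> b) x" T w] by (auto simp: slice_def)
    next
      case (2 S)
      then show ?thesis using cn[of S w] point(2)[OF x _ w0] by simp
    qed
    then show ?thesis using w0 by blast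
  qed
qed

section \<open>The section and the simplices containing its values\<close>

definition lifted :: "('a \<times> bool \<Rightarrow> real) \<Rightarrow> ('b \<times> bool) set" where
  "lifted x = {(w, b). weight (slice b x) (slice (\<not> b) x) w \<noteq> 0}"

text \<open>Used with \<open>\<sigma>\<close> empty, to see that lifting yields simplices, and with
  \<open>\<sigma>\<close> the support of a point over \<open>x\<close>, to compare the lift with
  that point. Only fibres of high vertices are kept from \<open>\<sigma>\<close>: when both sides
  have high vertices, a target contains those of the other side but can miss a light one, and a lift
  need not be adjacent to what lies above the latter.\<close>

lemma lifted_simplex:
  assumes x: "x \<in> box_points H"
    and \<sigma>: "\<sigma> = {} \<or> \<sigma> \<in> box_complex H' \<and> (\<forall>v b. x (v, b) \<noteq> 0 \<longleftrightarrow> (\<exists>A. (A, b) \<in> \<sigma> \<and> \<pi> A = v))"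
  shows "lifted x \<union> {(A, b) \<in> \<sigma>. \<pi> A \<in> high (slice b x)} \<in> box_complex H'"
    (is "?U \<in> _")
proof -
  have mem: "(w, b) \<in> lifted x \<longleftrightarrow>
      (\<exists>v\<in>high (slice b x). \<exists>T. target (slice b x) (slice (\<not> b) x) T \<and> w = \<ll> v T)" for w b
    by (simp add: lifted_def weight_nonzero)
  have high0: "x (v, b) \<noteq> 0" if "v \<in> high (slice b x)" for v b
    using that by (auto simp: high_def slice_def)
  have \<sigma>arc: "(A, B) \<in> parcs H'" if "(A, b) \<in> \<sigma>" "(B, \<not> b) \<in> \<sigma>" for A B b
  proof -
    have "\<sigma> \<in> box_complex H'" using \<sigma> that by blast
    then show ?thesis using that by (rule box_complexD(2)[OF H'])
  qed
  have \<sigma>x: "\<exists>A. (A, b) \<in> \<sigma> \<and> \<pi> A = v" if "x (v, b) \<noteq> 0" "\<sigma> \<noteq> {}" for v b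
    using \<sigma> that by blast
  have ll: "(w, w') \<in> parcs H'" if "(w, b) \<in> lifted x" "(w', \<not> b) \<in> lifted x" for w w' b
  proof -
    obtain v T where v: "v \<in> high (slice b x)" "target (slice b x) (slice (\<not> b) x) T" "w = \<ll> v T"
      using \<open>(w, b) \<in> lifted x\<close> unfolding mem by blast
    obtain v' T' where v': "v' \<in> high (slice (\<not> b) x)" "target (slice (\<not> b) x) (slice b x) T'" "w' = \<ll> v' T'"
      using \<open>(w', \<not> b) \<in> lifted x\<close> unfolding mem not_not by blast
    note T = target_both_high[OF x v(2) v'(1)]
    note T' = target_both_high[OF x, of "\<not> b", simplified, OF v'(2) v(1)]
    \<comment> \<open>Both targets consist of vertices present in \<open>x\<close>, on opposite
      sides.\<close>
    have "joined H T' T"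
      unfolding joined_def using T(2) T'(2) point(2)[OF x] by blast
    then show ?thesis
      unfolding v(3) v'(3) using T'(1) T(1) by (rule lift_lift)
  qed
  have l\<sigma>: "(w, B) \<in> parcs H'"
    if w: "(w, b) \<in> lifted x" and B: "(B, \<not> b) \<in> \<sigma>" "\<pi> B \<in> high (slice (\<not> b) x)" for w B b
  proof -
    obtain v T where v: "v \<in> high (slice b x)" "target (slice b x) (slice (\<not> b) x) T" "w = \<ll> v T"
      using w unfolding mem by auto
    note T = target_both_high[OF x v(2) B(2)]
    obtain A where A: "(A, b) \<in> \<sigma>" "\<pi> A = v"
      using \<sigma>x high0[OF v(1)] B(1) by blast
    \<comment> \<open>The lift dominates \<open>A\<close> here: each vertex of \<open>T\<close> is
      the image of some element of \<open>\<sigma>\<close> on the other side, and all of those are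
      adjacent to \<open>A\<close>.\<close>
    have "(\<ll> (\<pi> A) T, B) \<in> parcs H'"
      using \<sigma>arc[OF A(1) B(1)] T(1)
    proof (rule lift_arc)
      fix w assume "w \<in> T"
      then obtain B' where "(B', \<not> b) \<in> \<sigma>" "\<pi> B' = w"
        using \<sigma>x T(2) B(1) by blast
      then show "\<exists>B'. (A, B') \<in> parcs H' \<and> \<pi> B' = w"
        using \<sigma>arc[OF A(1)] by blast
    qed
    then show ?thesis by (simp add: A v(3))
  qed
  have cross: "(w, w') \<in> parcs H'" if "(w, b) \<in> ?U" "(w', \<not> b) \<in> ?U" for w w' b
  proof -
    consider "(w, b) \<in> lifted x" "(w', \<not> b) \<in> lifted x"
      | "(w, b) \<in> lifted x" "(w', \<not> b) \<in> \<sigma>" "\<pi> w' \<in> high (slice (\<not> b) x)"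
      | "(w', \<not> b) \<in> lifted x" "(w, b) \<in> \<sigma>" "\<pi> w \<in> high (slice b x)"
      | "(w, b) \<in> \<sigma>" "(w', \<not> b) \<in> \<sigma>"
      using \<open>(w, b) \<in> ?U\<close> \<open>(w', \<not> b) \<in> ?U\<close> by blast
    then show ?thesis
    proof cases
      case 3
      then show ?thesis using l\<sigma>[of w' "\<not> b" w] arc_sym by simp
    qed (use ll l\<sigma> \<sigma>arc in blast)+
  qed
  have ne: "(\<exists>w. (w, b) \<in> lifted x)" if hb: "high (slice b x) \<noteq> {}" for b
    using hb target_exists unfolding mem by blast
  have cn: "\<exists>C. \<forall>w. (w, b) \<in> ?U \<longrightarrow> (w, C) \<in> parcs H'" for b
  proof (cases "high (slice (\<not> b) x) = {}")
    case False
    then obtain C where "(C, \<not> b) \<in> lifted x" using ne by blast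
    then show ?thesis using cross by blast
  next
    case nb: True
    show ?thesis
    proof (cases "high (slice b x) = {}")
      case True
      then show ?thesis by (auto simp: mem)
    next
      case False
      then obtain v0 where v0: "x (v0, b) \<noteq> 0" using high0 by blast
      \<comment> \<open>A nonempty \<open>\<sigma>\<close> already has a common neighbour
        \<open>C0\<close> for side \<open>b\<close>; taking \<open>c\<close> to be its image keeps
        an element over \<open>c\<close> that is adjacent to that side.\<close>
      obtain C0 c where c: "\<And>v. x (v, b) \<noteq> 0 \<Longrightarrow> (v, c) \<in> parcs H"
        and C0: "\<And>A. (A, b) \<in> \<sigma> \<Longrightarrow> (A, C0) \<in> parcs H'" "\<sigma> \<noteq> {} \<Longrightarrow> \<pi> C0 = c"
      proof (cases "\<sigma> = {}")
        case True
        then show ?thesis using point(3)[OF x, of b] that by auto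
      next
        case False
        then obtain C0 where C0: "\<And>A. (A, b) \<in> \<sigma> \<Longrightarrow> (A, C0) \<in> parcs H'"
        proof -
          have "\<sigma> \<in> box_complex H'" using \<sigma> False by blast
          then show ?thesis using box_complexD(3)[OF H', of \<sigma> b] that by blast
        qed
        have "(v, \<pi> C0) \<in> parcs H" if "x (v, b) \<noteq> 0" for v
          using \<sigma>x[OF that False] C0 hom by blast
        then show ?thesis using that[of "\<pi> C0" C0] C0 by blast
      qed
      obtain w where w: "w = c \<or> x (w, \<not> b) \<noteq> 0"
        "\<And>T. target (slice b x) (slice (\<not> b) x) T \<Longrightarrow> w \<in> T"
        using target_common[OF x c v0] by blast
      \<comment> \<open>All elements of \<open>?U\<close> on side \<open>b\<close> lie over
        \<open>?S\<close>, and \<open>w\<close> belongs to every target, so the lift of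
        \<open>w\<close> along \<open>?S\<close> is adjacent to all of them.\<close>
      let ?S = "high (slice b x)"
      have "(z, \<ll> w ?S) \<in> parcs H'" if z: "(z, b) \<in> ?U" for z
      proof (cases "(z, b) \<in> lifted x")
        case True
        then obtain v T where v: "v \<in> ?S" "target (slice b x) (slice (\<not> b) x) T" "z = \<ll> v T"
          unfolding mem by blast
        show ?thesis
          unfolding v(3) by (rule lift_lift[OF joined_target[OF x v(2)] v(1) w(2)[OF v(2)]])
      next
        case False
        then have z: "(z, b) \<in> \<sigma>" "\<pi> z \<in> ?S" using z by auto
        then have ne: "\<sigma> \<noteq> {}" by blast
        obtain B where B: "\<pi> B = w" "\<And>A. (A, b) \<in> \<sigma> \<Longrightarrow> (A, B) \<in> parcs H'"
        proof (cases "w = c")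
          case True
          then show ?thesis using C0 ne that by blast
        next
          case False
          then obtain B where "(B, \<not> b) \<in> \<sigma>" "\<pi> B = w" using w(1) \<sigma>x ne by blast
          then show ?thesis using that \<sigma>arc by blast
        qed
        have "(\<ll> (\<pi> B) ?S, z) \<in> parcs H'"
        proof (rule lift_arc)
          show "(B, z) \<in> parcs H'" using B(2) z(1) arc_sym by blast
          fix v assume "v \<in> ?S"
          then obtain A where "(A, b) \<in> \<sigma>" "\<pi> A = v" using \<sigma>x high0 ne by blast
          then show "\<exists>A. (B, A) \<in> parcs H' \<and> \<pi> A = v" using B(2) arc_sym by blast
        qed fact
        then show ?thesis using arc_sym by (simp add: B(1))
      qed
      then show ?thesis by blast
    qed
  qed
  have "?U \<noteq> {}" using exists_high[OF x] ne by blast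
  then show ?thesis using cross cn by (rule box_complexI[OF H'])
qed

definition section_map :: "('a \<times> bool \<Rightarrow> real) \<Rightarrow> ('b \<times> bool \<Rightarrow> real)" where
  "section_map x = normalized H' (\<lambda>(w, b). weight (slice b x) (slice (\<not> b) x) w)"

lemma lifted_box_complex: "x \<in> box_points H \<Longrightarrow> lifted x \<in> box_complex H'"
  using lifted_simplex[of x "{}"] by simp

lemma weight_support: "{u. (\<lambda>(w, b). weight (slice b x) (slice (\<not> b) x) w) u \<noteq> 0} = lifted x"
  by (auto simp: lifted_def)

lemma section_map_nonzero:
  assumes "x \<in> box_points H"
  shows "{u. section_map x u \<noteq> 0} = lifted x"
  unfolding section_map_def
  by (subst normalized_box_points(3)[OF H'])
    (use lifted_box_complex[OF assms] in \<open>auto simp: weight_support weight_nonneg lifted_def\<close>)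

lemma Z2_map_section_map: "Z2_map (box_space H) (box_space H') section_map"
proof -
  have "Z2_map (box_space H) (box_space H')
      (\<lambda>x. normalized H' ((\<lambda>x (w, b). weight (slice b x) (slice (\<not> b) x) w) x))"
  proof (rule Z2_map_normalized[OF H H'])
    fix u :: "'b \<times> bool"
    obtain w b where u: "u = (w, b)" by force
    have [continuous_intros]: "continuous_on (box_points H) (\<lambda>x. slice b x v)" for b v
      unfolding slice_def by (rule continuous_on_subset[OF continuous_on_product_coordinates]) simp
    have [continuous_intros]: "continuous_on (box_points H) (\<lambda>x. faint (slice b x))" for b
      unfolding faint_def by (intro continuous_intros)
    have "continuous_on (box_points H) (\<lambda>x. if v \<in> T then ramp 0 (slice b x v) else 1 - ramp 0 (slice b x v))"
      for v T b by (cases "v \<in> T"; simp; intro continuous_intros)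
    then have [continuous_intros]: "continuous_on (box_points H) (\<lambda>x. layer (slice b x) T)" for b T
      unfolding layer_def by (intro continuous_intros)
    show "continuous_on (box_points H) (\<lambda>x. (\<lambda>(w, b). weight (slice b x) (slice (\<not> b) x) w) u)"
      unfolding u prod.case weight_def by (intro continuous_intros)
  next
    fix x :: "'a \<times> bool \<Rightarrow> real" and u :: "'b \<times> bool"
    show "0 \<le> (\<lambda>(w, b). weight (slice b x) (slice (\<not> b) x) w) u"
      by (simp add: case_prod_beta weight_nonneg)
  next
    fix x assume "x \<in> box_points H"
    then show "{u. (\<lambda>(w, b). weight (slice b x) (slice (\<not> b) x) w) u \<noteq> 0} \<in> box_complex H'"
      unfolding weight_support by (rule lifted_box_complex)
  next
    fix x :: "'a \<times> bool \<Rightarrow> real"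
    have "slice b (flip x) = slice (\<not> b) x" for b
      by (simp add: slice_def)
    then show "(\<lambda>(w, b). weight (slice b (flip x)) (slice (\<not> b) (flip x)) w) =
        flip (\<lambda>(w, b). weight (slice b x) (slice (\<not> b) x) w)"
      by (intro ext) (simp add: flip_def split: prod.split)
  qed
  then show ?thesis by (simp add: section_map_def[abs_def])
qed

section \<open>Removal of light fibres, and the two homotopies\<close>

definition trimmed :: "('b \<times> bool \<Rightarrow> real) \<Rightarrow> ('b \<times> bool \<Rightarrow> real)" where
  "trimmed y = (\<lambda>(A, b). y (A, b) * ramp 2 (box_map H' \<pi> y (\<pi> A, b)))"

lemma Z2_map_projection: "Z2_map (box_space H') (box_space H) (box_map H' \<pi>)"
  using H' H hom by (rule Z2_map_box_map)

lemma box_map_point: "y \<in> box_points H' \<Longrightarrow> box_map H' \<pi> y \<in> box_points H"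
  using Z2_map_projection unfolding Z2_map_box_iff[OF H' H] by blast

text \<open>What survives is the part that \<open>lifted_simplex\<close> admits. It is nonempty
  because some vertex of the projection is above the top window.\<close>

lemma trimmed_support:
  assumes y: "y \<in> box_points H'"
  shows "{u. trimmed y u \<noteq> 0} =
    {(A, b) \<in> {u. y u \<noteq> 0}. \<pi> A \<in> high (slice b (box_map H' \<pi> y))}" (is "?L = ?R")
    and "{u. trimmed y u \<noteq> 0} \<in> box_complex H'"
proof -
  have "\<pi> A \<in> pverts H" if "y (A, b) \<noteq> 0" for A b
  proof -
    have "{u. y u \<noteq> 0} \<in> box_complex H'" using y by (simp add: box_points_iff[OF H'])
    from box_complexD(3)[OF H' this, of b] have "\<exists>C. (A, C) \<in> parcs H'"
      using that by auto
    then show ?thesis using hom arcs_pverts by blast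
  qed
  then show eq: "?L = ?R"
    by (auto simp: trimmed_def high_def slice_def ramp_eq_0_iff not_le)
  obtain b v where v: "v \<in> high (slice b (box_map H' \<pi> y))"
    using exists_high[OF box_map_point[OF y]] by blast
  then have "box_map H' \<pi> y (v, b) \<noteq> 0" by (auto simp: high_def slice_def)
  then obtain A where "y (A, b) \<noteq> 0" "\<pi> A = v"
    unfolding box_map_nonzero[OF H' y] by blast
  then have "(A, b) \<in> ?R" using v by simp
  then have ne: "?R \<noteq> {}" by blast
  have "{u. y u \<noteq> 0} \<in> box_complex H'" using y by (simp add: box_points_iff[OF H'])
  from box_complex_subset[OF H' this _ ne] show "?L \<in> box_complex H'"
    unfolding eq by auto
qed

lemma trimmed_nonneg: "y \<in> box_points H' \<Longrightarrow> 0 \<le> trimmed y u"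
  by (auto simp: trimmed_def box_points_iff[OF H'] split: prod.split)

lemma normalized_trimmed_support:
  assumes "y \<in> box_points H'"
  shows "{u. normalized H' (trimmed y) u \<noteq> 0} = {u. trimmed y u \<noteq> 0}"
  by (rule normalized_box_points(3)[OF H' trimmed_nonneg[OF assms] trimmed_support(2)[OF assms]])

lemma Z2_map_trimmed: "Z2_map (box_space H') (box_space H') (\<lambda>y. normalized H' (trimmed y))"
proof (rule Z2_map_normalized[OF H' H'])
  note p = Z2_map_projection[unfolded Z2_map_box_iff[OF H' H]]
  fix u :: "'b \<times> bool"
  obtain A b where u: "u = (A, b)" by force
  have "continuous_on (box_points H') (\<lambda>y. box_map H' \<pi> y (\<pi> A, b))"
    using p by (blast intro: continuous_on_product_then_coordinatewise)
  then show "continuous_on (box_points H') (\<lambda>y. trimmed y u)"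
    unfolding trimmed_def u prod.case
    by (intro continuous_intros continuous_on_subset[OF continuous_on_product_coordinates]) auto
next
  note p = Z2_map_projection[unfolded Z2_map_box_iff[OF H' H]]
  fix y assume "y \<in> box_points H'"
  then have "box_map H' \<pi> (flip y) = flip (box_map H' \<pi> y)" using p by blast
  then show "trimmed (flip y) = flip (trimmed y)"
    by (simp add: trimmed_def fun_eq_iff)
qed (use trimmed_nonneg trimmed_support in auto)

theorem Z2_homotopy_equivalence_box_map:
  "Z2_homotopy_equivalence (box_space H') (box_space H) (box_map H' \<pi>)"
proof -
  note p = Z2_map_projection
  have id: "Z2_map (box_space K) (box_space K) id" for K :: "'c pair_pre_digraph"
    by (simp add: Z2_map_def equivariant_def)
  have "Z2_homotopic (box_space H) (box_space H) (box_map H' \<pi> \<circ> section_map) id"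
  proof (rule Z2_homotopic_linear[OF H H Z2_map_comp[OF Z2_map_section_map p] id])
    fix x assume x: "x \<in> box_points H"
    have s: "section_map x \<in> box_points H'"
      using Z2_map_section_map x unfolding Z2_map_box_iff[OF H H'] by blast
    \<comment> \<open>Only high vertices are lifted, and they project back to themselves; so the
      support of \<open>x\<close> is the common simplex.\<close>
    have "x (v, b) \<noteq> 0" if nz: "box_map H' \<pi> (section_map x) (v, b) \<noteq> 0" for v b
    proof -
      obtain A where A: "section_map x (A, b) \<noteq> 0" "\<pi> A = v"
        using nz unfolding box_map_nonzero[OF H' s] by blast
      then have "(A, b) \<in> lifted x" using section_map_nonzero[OF x] by blast
      then have "v \<in> high (slice b x)"
        using A(2) by (auto simp: lifted_def weight_nonzero)
      then show ?thesis by (auto simp: high_def slice_def)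
    qed
    then have "{u. (box_map H' \<pi> \<circ> section_map) x u \<noteq> 0} \<union> {u. id x u \<noteq> 0} \<subseteq> {u. x u \<noteq> 0}"
      by auto
    moreover have "{u. x u \<noteq> 0} \<in> box_complex H" using x by (simp add: box_points_iff[OF H])
    ultimately show "\<exists>\<sigma>\<in>box_complex H.
        {u. (box_map H' \<pi> \<circ> section_map) x u \<noteq> 0} \<union> {u. id x u \<noteq> 0} \<subseteq> \<sigma>" by blast
  qed
  \<comment> \<open>The intermediate map shares a simplex with each end: with the lift because only
    high fibres remain, with the identity because trimming shrinks the support.\<close>
  moreover have "Z2_homotopic (box_space H') (box_space H') (section_map \<circ> box_map H' \<pi>) id"
  proof (rule Z2_homotopic_trans)
    show "Z2_homotopic (box_space H') (box_space H') (section_map \<circ> box_map H' \<pi>)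
        (\<lambda>y. normalized H' (trimmed y))"
    proof (rule Z2_homotopic_linear[OF H' H' Z2_map_comp[OF p Z2_map_section_map] Z2_map_trimmed])
      fix y assume y: "y \<in> box_points H'"
      let ?x = "box_map H' \<pi> y"
      have x: "?x \<in> box_points H" by (rule box_map_point[OF y])
      have "lifted ?x \<union> {(A, b) \<in> {u. y u \<noteq> 0}. \<pi> A \<in> high (slice b ?x)} \<in> box_complex H'"
        using y by (intro lifted_simplex[OF x]) (auto simp: box_map_nonzero[OF H' y] box_points_iff[OF H'])
      then show "\<exists>\<sigma>\<in>box_complex H'. {u. (section_map \<circ> box_map H' \<pi>) y u \<noteq> 0} \<union>
          {u. normalized H' (trimmed y) u \<noteq> 0} \<subseteq> \<sigma>"
        unfolding normalized_trimmed_support[OF y] trimmed_support(1)[OF y] comp_apply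
          section_map_nonzero[OF x] by blast
    qed
    show "Z2_homotopic (box_space H') (box_space H') (\<lambda>y. normalized H' (trimmed y)) id"
    proof (rule Z2_homotopic_linear[OF H' H' Z2_map_trimmed id])
      fix y assume y: "y \<in> box_points H'"
      then have "{u. y u \<noteq> 0} \<in> box_complex H'" by (simp add: box_points_iff[OF H'])
      moreover have "{u. normalized H' (trimmed y) u \<noteq> 0} \<union> {u. id y u \<noteq> 0} \<subseteq> {u. y u \<noteq> 0}"
        unfolding normalized_trimmed_support[OF y] trimmed_support(1)[OF y] by auto
      ultimately show "\<exists>\<sigma>\<in>box_complex H'.
          {u. normalized H' (trimmed y) u \<noteq> 0} \<union> {u. id y u \<noteq> 0} \<subseteq> \<sigma>" by blast
    qed
  qed
  ultimately show ?thesis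
    using p Z2_map_section_map unfolding Z2_homotopy_equivalence_def by blast
qed

end

section \<open>The projection of \<open>\<Omega>\<close>\<close>

lemma joined_sym:
  assumes "pair_pseudo_graph G" "joined G A B"
  shows "joined G B A"
proof -
  interpret pair_pseudo_graph G by fact
  show ?thesis using assms(2) by (auto simp: joined_def intro: arcs_symmetric)
qed

lemma joined_mono: "joined G A B \<Longrightarrow> A' \<subseteq> A \<Longrightarrow> B' \<subseteq> B \<Longrightarrow> joined G A' B'"
  by (auto simp: joined_def)

lemma ball_Suc_iff: "(\<forall>i\<in>{1..l}. P (i - 1) i) \<longleftrightarrow> (\<forall>i<l. P i (Suc i))"
proof
  assume *: "\<forall>i<l. P i (Suc i)"
  show "\<forall>i\<in>{1..l}. P (i - 1) i"
  proof
    fix i assume "i \<in> {1..l}"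
    then show "P (i - 1) i" using * by (cases i) auto
  qed
next
  assume *: "\<forall>i\<in>{1..l}. P (i - 1) i"
  show "\<forall>i<l. P i (Suc i)"
  proof (intro allI impI)
    fix i assume "i < l"
    then show "P i (Suc i)" using bspec[OF *, of "Suc i"] by simp
  qed
qed

lemma Omega_verts_iff:
  "A \<in> Omega_verts l G \<longleftrightarrow> length A = Suc l \<and> (\<forall>i\<le>l. A ! i \<subseteq> pverts G) \<and> card (A ! 0) = 1 \<and>
    (\<forall>i<l. joined G (A ! i) (A ! Suc i))"
  unfolding Omega_verts_def mem_Collect_eq ball_Suc_iff[of l "\<lambda>i j. joined G (A ! i) (A ! j)"] by simp

lemma Omega_arc_iff:
  "(A, B) \<in> parcs (Omega l G) \<longleftrightarrow> A \<in> Omega_verts l G \<and> B \<in> Omega_verts l G \<and>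
    (\<forall>i<l. A ! i \<subseteq> B ! Suc i \<and> B ! i \<subseteq> A ! Suc i) \<and> joined G (A ! l) (B ! l)"
  unfolding Omega_def using ball_Suc_iff[of l "\<lambda>i j. A ! i \<subseteq> B ! j \<and> B ! i \<subseteq> A ! j"] by simp

lemma Omega_verts_snoc:
  "A @ [X] \<in> Omega_verts (Suc l) G \<longleftrightarrow> A \<in> Omega_verts l G \<and> X \<subseteq> pverts G \<and> joined G (A ! l) X"
proof (cases "length A = Suc l")
  case True
  have 1: "(\<forall>i\<le>Suc l. (A @ [X]) ! i \<subseteq> pverts G) \<longleftrightarrow> (\<forall>i\<le>l. A ! i \<subseteq> pverts G) \<and> X \<subseteq> pverts G"
    using True by (simp add: less_Suc_eq_le[symmetric] All_less_Suc[of "Suc l"] nth_append conj_commute)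
  have 2: "(\<forall>i<Suc l. joined G ((A @ [X]) ! i) ((A @ [X]) ! Suc i)) \<longleftrightarrow>
      (\<forall>i<l. joined G (A ! i) (A ! Suc i)) \<and> joined G (A ! l) X"
    using True by (simp add: All_less_Suc[of l] nth_append conj_commute)
  have "card ((A @ [X]) ! 0) = card (A ! 0)"
    using True by (simp add: nth_append)
  then show ?thesis
    unfolding Omega_verts_iff 1 2 using True by auto
qed (simp add: Omega_verts_iff)

lemma Omega_arc_snoc:
  assumes G: "pair_pseudo_graph G"
  shows "(A @ [X], B @ [Y]) \<in> parcs (Omega (Suc l) G) \<longleftrightarrow> (A, B) \<in> parcs (Omega l G) \<and>
    X \<subseteq> pverts G \<and> Y \<subseteq> pverts G \<and> A ! l \<subseteq> Y \<and> B ! l \<subseteq> X \<and> joined G X Y"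
proof (cases "length A = Suc l \<and> length B = Suc l")
  case True
  have 1: "(\<forall>i<Suc l. (A @ [X]) ! i \<subseteq> (B @ [Y]) ! Suc i \<and> (B @ [Y]) ! i \<subseteq> (A @ [X]) ! Suc i) \<longleftrightarrow>
      (\<forall>i<l. A ! i \<subseteq> B ! Suc i \<and> B ! i \<subseteq> A ! Suc i) \<and> A ! l \<subseteq> Y \<and> B ! l \<subseteq> X"
    using True by (simp add: All_less_Suc[of l] nth_append conj_commute)
  have 2: "(A @ [X]) ! Suc l = X" "(B @ [Y]) ! Suc l = Y"
    using True by (simp_all add: nth_append)
  \<comment> \<open>Joining the new coordinates subsumes the old conditions: \<open>X\<close>
    contains \<open>B ! l\<close> and \<open>Y\<close> contains \<open>A ! l\<close>, so these are
    joined to each other and to the coordinates appended to them.\<close>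
  have "joined G (A ! l) X \<and> joined G (B ! l) Y \<and> joined G (A ! l) (B ! l)"
    if "joined G X Y" "A ! l \<subseteq> Y" "B ! l \<subseteq> X"
    using joined_mono[OF joined_sym[OF G that(1)] that(2) subset_refl] joined_mono[OF that(1,3) subset_refl]
      joined_mono[OF joined_sym[OF G that(1)] that(2,3)] by (intro conjI)
  then show ?thesis
    unfolding Omega_arc_iff Omega_verts_snoc 1 2 by argo
qed (auto simp: Omega_arc_iff Omega_verts_iff)

lemma Omega_arc_butlast:
  assumes "(A, B) \<in> parcs (Omega (Suc l) G)"
  obtains A' X B' Y where "A = A' @ [X]" "B = B' @ [Y]"
proof -
  have "A \<noteq> []" "B \<noteq> []" using assms by (auto simp: Omega_arc_iff Omega_verts_iff)
  then show ?thesis using that append_butlast_last_id by metis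
qed

text \<open>If the neighbours of \<open>A' @ [X]\<close> cover \<open>T\<close>, then
  \<open>X\<close> contains the last coordinate of each member of \<open>T\<close>. The union of
  these is the least such \<open>X\<close>, and shrinking \<open>X\<close> to it loses no neighbour
  over \<open>T\<close>.\<close>

lemma lifting_Omega_Suc:
  assumes G: "pair_pseudo_graph G"
  shows "lifting (Omega l G) (Omega (Suc l) G) butlast (\<lambda>A T. A @ [(\<Union>B\<in>T. B ! l)])"
proof (rule lifting.intro)
  show "pair_pseudo_graph (Omega l G)" "pair_pseudo_graph (Omega (Suc l) G)"
    using Omega_pseudo_graph[OF G] by auto
next
  fix A B assume AB: "(A, B) \<in> parcs (Omega (Suc l) G)"
  then obtain A' X B' Y where eq: "A = A' @ [X]" "B = B' @ [Y]"
    by (rule Omega_arc_butlast)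
  show "(butlast A, butlast B) \<in> parcs (Omega l G)"
    using AB unfolding eq Omega_arc_snoc[OF G] by simp
next
  fix S T A B assume j: "joined (Omega l G) S T" and A: "A \<in> S" and B: "B \<in> T"
  have arc: "(A', B') \<in> parcs (Omega l G)" if "A' \<in> S" "B' \<in> T" for A' B'
    using j that by (auto simp: joined_def)
  have "joined G (B' ! l) (A' ! l)" if "A' \<in> S" "B' \<in> T" for A' B'
    using arc[OF that] joined_sym[OF G] by (auto simp: Omega_arc_iff)
  then have "joined G (\<Union>B\<in>T. B ! l) (\<Union>A\<in>S. A ! l)"
    by (auto simp: joined_def)
  moreover have "B' ! l \<subseteq> pverts G" if "B' \<in> T" for B'
    using arc[OF A that] by (auto simp: Omega_arc_iff Omega_verts_iff)
  moreover have "A' ! l \<subseteq> pverts G" if "A' \<in> S" for A'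
    using arc[OF that B] by (auto simp: Omega_arc_iff Omega_verts_iff)
  ultimately show "(A @ [(\<Union>B\<in>T. B ! l)], B @ [(\<Union>A\<in>S. A ! l)]) \<in> parcs (Omega (Suc l) G)"
    unfolding Omega_arc_snoc[OF G] using arc[OF A B] A B by auto
next
  fix A B T
  assume AB: "(A, B) \<in> parcs (Omega (Suc l) G)" and B: "butlast B \<in> T"
    and T: "\<And>w. w \<in> T \<Longrightarrow> \<exists>B'. (A, B') \<in> parcs (Omega (Suc l) G) \<and> butlast B' = w"
  obtain A' X B' Y where eq: "A = A' @ [X]" "B = B' @ [Y]"
    using AB by (rule Omega_arc_butlast)
  have "w ! l \<subseteq> X" if w: "w \<in> T" for w
  proof -
    obtain C where C: "(A, C) \<in> parcs (Omega (Suc l) G)" "butlast C = w" using T[OF w] by blast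
    obtain C' Z where C': "C = C' @ [Z]" using C(1) by (auto elim: Omega_arc_butlast)
    show ?thesis using C unfolding eq C' Omega_arc_snoc[OF G] by auto
  qed
  then have sub: "(\<Union>w\<in>T. w ! l) \<subseteq> X" by blast
  show "(butlast A @ [(\<Union>w\<in>T. w ! l)], B) \<in> parcs (Omega (Suc l) G)"
    using AB B sub joined_mono[OF _ sub subset_refl, of G Y] unfolding eq Omega_arc_snoc[OF G] by auto
qed simp

lemma Omega_verts_0: "A \<in> Omega_verts 0 G \<longleftrightarrow> (\<exists>v\<in>pverts G. A = [{v}])"
proof
  assume "A \<in> Omega_verts 0 G"
  then have A: "length A = 1" "A ! 0 \<subseteq> pverts G" "card (A ! 0) = 1"
    by (auto simp: Omega_verts_iff)
  obtain v where "A ! 0 = {v}" using A(3) by (rule card_1_singletonE)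
  then show "\<exists>v\<in>pverts G. A = [{v}]"
    using A(1,2) by (auto simp: length_Suc_conv)
qed (auto simp: Omega_verts_iff)

text \<open>\<open>Omega 0 G\<close> is a copy of \<open>G\<close>, each vertex \<open>v\<close>
  written as \<open>[{v}]\<close>, so there is only one way to lift.\<close>

lemma lifting_Omega_0:
  assumes G: "pair_pseudo_graph G"
  shows "lifting G (Omega 0 G) Omega_proj (\<lambda>v T. [{v}])"
proof (rule lifting.intro)
  interpret pair_pseudo_graph G by fact
  show "pair_pseudo_graph G" by fact
  show "pair_pseudo_graph (Omega 0 G)" by (rule Omega_pseudo_graph[OF G])
  show proj: "Omega_proj [{v}] = v" for v :: 'a by (simp add: Omega_proj_def)
  show "(Omega_proj A, Omega_proj B) \<in> parcs G" if "(A, B) \<in> parcs (Omega 0 G)" for A B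
    using Omega_proj_hom(2)[OF G that] .
  show "([{v}], [{w}]) \<in> parcs (Omega 0 G)" if "joined G S T" "v \<in> S" "w \<in> T" for S T v w
    using that in_arcsD1[of v w] in_arcsD2[of v w]
    by (auto simp: Omega_arc_iff Omega_verts_0 joined_def)
  show "([{Omega_proj A}], B) \<in> parcs (Omega 0 G)" if "(A, B) \<in> parcs (Omega 0 G)" for A B
    using that by (auto simp: Omega_arc_iff Omega_verts_0 proj)
qed

lemma Omega_proj_equivalence:
  assumes G: "pair_pseudo_graph G"
  shows "Z2_homotopy_equivalence (box_space (Omega k G)) (box_space G) (box_map (Omega k G) Omega_proj)"
proof (induction k)
  case 0
  show ?case
    by (rule lifting.Z2_homotopy_equivalence_box_map[OF lifting_Omega_0[OF G]])
next
  case (Suc k)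
  have hom: "\<And>A B. (A, B) \<in> parcs (Omega (Suc k) G) \<Longrightarrow> (butlast A, butlast B) \<in> parcs (Omega k G)"
    using lifting_Omega_Suc[OF G] by (rule lifting.hom)
  let ?f = "box_map (Omega k G) Omega_proj \<circ> box_map (Omega (Suc k) G) butlast"
  \<comment> \<open>The two projections agree on tuples, which here have at least two coordinates,
    and the induced maps see nothing else.\<close>
  have eq: "box_map (Omega (Suc k) G) (\<lambda>A. Omega_proj (butlast A)) = box_map (Omega (Suc k) G) Omega_proj"
  proof -
    have "Omega_proj (butlast A) = Omega_proj A" if "(A, b) \<in> \<Union>(box_complex (Omega (Suc k) G))" for A b
      using that unfolding Union_box_complex[OF Omega_pseudo_graph[OF G]]
      by (auto simp: Omega_def Omega_verts_iff Omega_proj_def nth_butlast)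
    then have "(\<lambda>(A, b). (Omega_proj (butlast A), b)) u = (\<lambda>(A, b). (Omega_proj A, b)) u"
      if "u \<in> \<Union>(box_complex (Omega (Suc k) G))" for u
      using that by (cases u) simp
    then show ?thesis
      unfolding box_map_def linear_ext_def by (intro ext sum.cong refl) simp
  qed
  have "?f = box_map (Omega (Suc k) G) Omega_proj"
    unfolding eq[symmetric] comp_def
    by (intro ext box_map_comp[where h = butlast, OF Omega_pseudo_graph[OF G] Omega_pseudo_graph[OF G] hom])
  moreover have "Z2_homotopy_equivalence (box_space (Omega (Suc k) G)) (box_space G) ?f"
    using lifting.Z2_homotopy_equivalence_box_map[OF lifting_Omega_Suc[OF G]] Suc.IH
    by (rule Z2_homotopy_equivalence_comp)
  ultimately show ?case by simp
qed

section \<open>The map with small images of simplices\<close>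

text \<open>Adjacent tuples \<open>A\<close>, \<open>B\<close> interleave to increasing chains $A_0\subseteq B_1\subseteq A_2\subseteq\dots$\<close>

definition zigzag :: "'a set list \<Rightarrow> 'a set list \<Rightarrow> nat \<Rightarrow> 'a set" where
  "zigzag A B i = (if even i then A ! i else B ! i)"

lemma zigzag_mono:
  assumes "(A, B) \<in> parcs (Omega k G)" "i \<le> j" "j \<le> k"
  shows "zigzag A B i \<subseteq> zigzag A B j"
  using assms(2,3)
proof (induction j rule: dec_induct)
  case (step j)
  then have "zigzag A B j \<subseteq> zigzag A B (Suc j)"
    using assms(1) by (auto simp: Omega_arc_iff zigzag_def)
  then show ?case using step by simp
qed simp

lemma Omega_arc_sym:
  assumes "pair_pseudo_graph G" "(A, B) \<in> parcs (Omega k G)"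
  shows "(B, A) \<in> parcs (Omega k G)"
proof -
  interpret pair_pseudo_graph "Omega k G" by (rule Omega_pseudo_graph[OF assms(1)])
  show ?thesis by (rule arcs_symmetric[OF assms(2)])
qed

text \<open>At index \<open>k\<close> the two chains end in \<open>A ! k\<close> and
  \<open>B ! k\<close>, in one order or the other, and these are joined; monotonicity carries this
  down to all pairs of indices.\<close>

lemma zigzag_joined:
  assumes G: "pair_pseudo_graph G" and AB: "(A, B) \<in> parcs (Omega k G)" and ij: "i \<le> k" "j \<le> k"
  shows "joined G (zigzag A B i) (zigzag B A j)"
proof (rule joined_mono)
  show "joined G (zigzag A B k) (zigzag B A k)"
    using AB joined_sym[OF G] by (auto simp: Omega_arc_iff zigzag_def)
  show "zigzag A B i \<subseteq> zigzag A B k"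
    using zigzag_mono[OF AB] ij by simp
  show "zigzag B A j \<subseteq> zigzag B A k"
    using zigzag_mono[OF Omega_arc_sym[OF G AB]] ij by simp
qed

lemma Omega_verts_hd:
  assumes "A \<in> Omega_verts k G"
  shows "A ! 0 = {Omega_proj A}"
proof -
  have "card (A ! 0) = 1" using assms by (simp add: Omega_verts_iff)
  then show ?thesis by (metis card_1_singletonE Omega_proj_def the_elem_eq)
qed

lemma zigzag_0: "(A, B) \<in> parcs (Omega k G) \<Longrightarrow> zigzag A B 0 = {Omega_proj A}"
  using Omega_verts_hd by (auto simp: zigzag_def Omega_arc_iff)

lemma zigzag_nonempty:
  assumes "(A, B) \<in> parcs (Omega k G)" "i \<le> k"
  shows "Omega_proj A \<in> zigzag A B i"
  using zigzag_mono[OF assms(1) _ assms(2), of 0] zigzag_0[OF assms(1)] by auto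

section \<open>The simplex carrying the images of a simplex under both maps\<close>

definition carrier_simplex :: "nat \<Rightarrow> ('a set list \<times> bool) set \<Rightarrow> ('a \<times> bool) set" where
  "carrier_simplex k \<sigma> = {(v, b \<noteq> odd i) | v b i. \<exists>A. (A, b) \<in> \<sigma> \<and> i \<le> k \<and> v \<in> A ! i}"

lemma carrier_simplexI:
  "(A, b) \<in> \<sigma> \<Longrightarrow> i \<le> k \<Longrightarrow> v \<in> A ! i \<Longrightarrow> c = (b \<noteq> odd i) \<Longrightarrow> (v, c) \<in> carrier_simplex k \<sigma>"
  unfolding carrier_simplex_def by blast

lemma carrier_simplex_mono: "\<sigma> \<subseteq> \<tau> \<Longrightarrow> carrier_simplex k \<sigma> \<subseteq> carrier_simplex k \<tau>"
  unfolding carrier_simplex_def by blast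

lemma box_complex_arc:
  assumes H: "pair_pseudo_graph H" and \<sigma>: "\<sigma> \<in> box_complex H" "(A, b) \<in> \<sigma>"
  obtains B where "(A, B) \<in> parcs H"
  using box_complexD(3)[OF H \<sigma>(1), of b] \<sigma>(2) by blast

text \<open>Tuples on opposite sides interleave directly, tuples on the same side through a common
  neighbour. Once both sides are inhabited, a vertex of one is a common neighbour of the
  other.\<close>

lemma carrier_simplex_box_complex:
  assumes G: "pair_pseudo_graph G" and k: "k \<ge> 1" and \<sigma>: "\<sigma> \<in> box_complex (Omega k G)"
  shows "carrier_simplex k \<sigma> \<in> box_complex G"
proof -
  note H = Omega_pseudo_graph[OF G, of k]
  \<comment> \<open>Even coordinates of \<open>A\<close> and odd ones of \<open>A'\<close> fall on
    opposite sides. With a common neighbour \<open>B\<close>, the former lie in the chain of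
    \<open>A\<close> and \<open>B\<close>, the latter in that of \<open>B\<close> and
    \<open>A'\<close>, and the ends of these chains are joined.\<close>
  have same: "(v, w) \<in> parcs G"
    if A: "(A, b) \<in> \<sigma>" "i \<le> k" "v \<in> A ! i" and A': "(A', b) \<in> \<sigma>" "j \<le> k" "w \<in> A' ! j"
      and i: "even i" and j: "odd j" for v w A A' b i j
  proof -
    obtain B where B: "(A, B) \<in> parcs (Omega k G)" "(A', B) \<in> parcs (Omega k G)"
      using box_complexD(3)[OF H \<sigma>, of b] A(1) A'(1) by blast
    have "v \<in> zigzag A B k"
      using zigzag_mono[OF B(1) A(2) order_refl] A(3) i by (auto simp: zigzag_def)
    moreover have "w \<in> zigzag B A' k"
      using zigzag_mono[OF Omega_arc_sym[OF G B(2)] A'(2) order_refl] A'(3) j by (auto simp: zigzag_def)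
    moreover have "joined G (zigzag A B k) (zigzag B A' k)"
    proof (cases "even k")
      case True
      then show ?thesis using zigzag_joined[OF G B(1) order_refl order_refl] by (simp add: zigzag_def)
    next
      case False
      then show ?thesis
        using zigzag_joined[OF G B(2) order_refl order_refl] joined_sym[OF G] by (simp add: zigzag_def)
    qed
    ultimately show ?thesis by (auto simp: joined_def)
  qed
  have arc: "(v, w) \<in> parcs G" if v: "(v, c) \<in> carrier_simplex k \<sigma>" and w: "(w, \<not> c) \<in> carrier_simplex k \<sigma>" for v w c
  proof -
    obtain A b i where A: "(A, b) \<in> \<sigma>" "i \<le> k" "v \<in> A ! i" "c = (b \<noteq> odd i)"
      using v by (auto simp: carrier_simplex_def)
    obtain A' b' j where A': "(A', b') \<in> \<sigma>" "j \<le> k" "w \<in> A' ! j" "(\<not> c) = (b' \<noteq> odd j)"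
      using w by (auto simp: carrier_simplex_def)
    show ?thesis
    proof (cases "b' = b")
      case True
      show ?thesis
      proof (cases "even i")
        case even: True
        then show ?thesis using same[OF A(1-3)] A' A(4) True by auto
      next
        case odd: False
        then have "even j" using A(4) A'(4) True by auto
        then have "(w, v) \<in> parcs G" using same[of A' b j w A i v] A' A True odd by simp
        then show ?thesis
          using joined_sym[OF G, of "{w}" "{v}"] by (simp add: joined_def)
      qed
    next
      case False
      then have b': "b' = (\<not> b)" by simp
      have arc: "(A, A') \<in> parcs (Omega k G)"
        using box_complexD(2)[OF H \<sigma> A(1)] A'(1) b' by simp
      have par: "even i \<longleftrightarrow> even j" using A(4) A'(4) b' by auto
      show ?thesis
      proof (cases "even i")
        case True
        then show ?thesis
          using zigzag_joined[OF G arc A(2) A'(2)] A(3) A'(3) par by (simp add: zigzag_def joined_def)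
      next
        case False
        then show ?thesis
          using zigzag_joined[OF G Omega_arc_sym[OF G arc] A(2) A'(2)] A(3) A'(3) par
          by (simp add: zigzag_def joined_def)
      qed
    qed
  qed
  obtain A b where A: "(A, b) \<in> \<sigma>" using box_complexD(1)[OF H \<sigma>] by auto
  obtain B where B: "(A, B) \<in> parcs (Omega k G)" using box_complex_arc[OF H \<sigma> A] .
  have "Omega_proj A \<in> A ! 0"
    using zigzag_nonempty[OF B, of 0] by (simp add: zigzag_def)
  then have 0: "(Omega_proj A, b) \<in> carrier_simplex k \<sigma>"
    using A by (intro carrier_simplexI[of A b _ 0]) auto
  \<comment> \<open>Here \<open>k \<ge> 1\<close> enters: coordinate 1 of \<open>A\<close> contains
    coordinate 0 of its neighbour, which puts a vertex on the side opposite to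
    \<open>b\<close>.\<close>
  have "Omega_proj B \<in> A ! 1"
    using zigzag_nonempty[OF Omega_arc_sym[OF G B] k] by (simp add: zigzag_def)
  then have "(Omega_proj B, \<not> b) \<in> carrier_simplex k \<sigma>"
    using A k by (intro carrier_simplexI[of A b _ 1]) auto
  with 0 have ne: "\<exists>v. (v, c) \<in> carrier_simplex k \<sigma>" for c
    by (cases "c = b") (simp_all, blast+)
  show ?thesis
  proof (rule box_complexI[OF G])
    show "carrier_simplex k \<sigma> \<noteq> {}" using 0 by blast
    show "\<exists>c. \<forall>v. (v, b) \<in> carrier_simplex k \<sigma> \<longrightarrow> (v, c) \<in> parcs G" for b
      using ne[of "\<not> b"] arc by blast
  qed (rule arc)
qed

section \<open>The averaged map and its homotopy to the projection\<close>

definition bary :: "'a set \<Rightarrow> bool \<Rightarrow> 'a \<times> bool \<Rightarrow> real" where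
  "bary C c u = (if u \<in> C \<times> {c} then 1 / card C else 0)"

definition spread :: "nat \<Rightarrow> 'a set list \<times> bool \<Rightarrow> 'a \<times> bool \<Rightarrow> real" where
  "spread k = (\<lambda>(A, b) w. (\<Sum>i\<le>k. bary (A ! i) (b \<noteq> odd i) w) / (k + 1))"

definition spread_map :: "'a pair_pre_digraph \<Rightarrow> nat \<Rightarrow> ('a set list \<times> bool \<Rightarrow> real) \<Rightarrow> ('a \<times> bool \<Rightarrow> real)" where
  "spread_map G k x w = (\<Sum>u\<in>\<Union>(box_complex (Omega k G)). x u * spread k u w)"

lemma bary_nonneg: "0 \<le> bary C c u"
  by (simp add: bary_def)

lemma spread_nonneg: "0 \<le> spread k u w"
  unfolding spread_def case_prod_beta by (intro divide_nonneg_nonneg sum_nonneg bary_nonneg) simp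

lemma bary_flip: "bary C (\<not> c) (v, b) = bary C c (v, \<not> b)"
  by (auto simp: bary_def)

lemma spread_flip: "spread k (A, \<not> b) (v, c) = spread k (A, b) (v, \<not> c)"
  unfolding spread_def prod.case bary_flip[symmetric] by (simp cong: sum.cong)

lemma spread_nonzero: "spread k (A, b) w \<noteq> 0 \<Longrightarrow> w \<in> carrier_simplex k {(A, b)}"
proof -
  assume "spread k (A, b) w \<noteq> 0"
  then have "(\<Sum>i\<le>k. bary (A ! i) (b \<noteq> odd i) w) \<noteq> 0" by (auto simp: spread_def)
  then obtain i where "i \<le> k" "bary (A ! i) (b \<noteq> odd i) w \<noteq> 0"
    by (metis (no_types, lifting) atMost_iff sum.neutral)
  then have "i \<le> k" "w \<in> (A ! i) \<times> {b \<noteq> odd i}"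
    by (auto simp: bary_def split: if_splits)
  then show ?thesis by (auto intro: carrier_simplexI)
qed

text \<open>The inequality is for norm estimates over an arbitrary finite \<open>V\<close>, the
  equality for total weights.\<close>

lemma sum_bary:
  assumes "finite V" "finite C" "C \<noteq> {}"
  shows "sum (bary C c) V \<le> 1" "C \<times> {c} \<subseteq> V \<Longrightarrow> sum (bary C c) V = 1"
proof -
  have eq: "sum (bary C c) V = card (V \<inter> C \<times> {c}) / card C"
    unfolding bary_def using sum.inter_restrict[OF assms(1), of "\<lambda>u. 1 / real (card C)" "C \<times> {c}"] by simp
  have "card (V \<inter> C \<times> {c}) \<le> card (C \<times> {c})"
    using assms by (intro card_mono) auto
  then show "sum (bary C c) V \<le> 1"
    unfolding eq using assms by (simp add: card_cartesian_product divide_le_eq_1 card_gt_0_iff)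
  show "sum (bary C c) V = 1" if "C \<times> {c} \<subseteq> V"
    unfolding eq using assms that by (simp add: Int_absorb1 card_cartesian_product)
qed

text \<open>Tuples may have empty coordinates, but such tuples are isolated: each chain grows from a
  singleton, and \<open>A ! i\<close> is a member of one of the two chains.\<close>

lemma Omega_coord:
  assumes G: "pair_pseudo_graph G" and AB: "(A, B) \<in> parcs (Omega k G)" and i: "i \<le> k"
  shows "finite (A ! i)" "A ! i \<noteq> {}"
proof -
  interpret pair_pseudo_graph G by fact
  have "A ! i \<subseteq> pverts G" using AB i by (auto simp: Omega_arc_iff Omega_verts_iff)
  then show "finite (A ! i)" using pair_finite_verts by (rule finite_subset)
  show "A ! i \<noteq> {}"
    using zigzag_nonempty[OF AB i] zigzag_nonempty[OF Omega_arc_sym[OF G AB] i]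
    by (auto simp: zigzag_def split: if_splits)
qed

lemma sum_spread:
  assumes G: "pair_pseudo_graph G" and k: "k \<ge> 1" and u: "(A, b) \<in> \<Union>(box_complex (Omega k G))"
  shows "sum (spread k (A, b)) (\<Union>(box_complex G)) = 1"
proof -
  let ?V = "\<Union>(box_complex G)"
  note H = Omega_pseudo_graph[OF G, of k]
  obtain \<sigma> where \<sigma>: "\<sigma> \<in> box_complex (Omega k G)" "(A, b) \<in> \<sigma>" using u by blast
  obtain B where B: "(A, B) \<in> parcs (Omega k G)" using box_complex_arc[OF H \<sigma>] .
  have sub: "(A ! i) \<times> {b \<noteq> odd i} \<subseteq> ?V" if "i \<le> k" for i
  proof -
    have "(A ! i) \<times> {b \<noteq> odd i} \<subseteq> carrier_simplex k \<sigma>"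
      using \<sigma>(2) that by (auto intro!: carrier_simplexI[of A b])
    then show ?thesis using carrier_simplex_box_complex[OF G k \<sigma>(1)] by blast
  qed
  have "sum (spread k (A, b)) ?V = (\<Sum>w\<in>?V. \<Sum>i\<le>k. bary (A ! i) (b \<noteq> odd i) w) / (k + 1)"
    unfolding spread_def prod.case by (simp add: sum_divide_distrib)
  also have "(\<Sum>w\<in>?V. \<Sum>i\<le>k. bary (A ! i) (b \<noteq> odd i) w) = (\<Sum>i\<le>k. sum (bary (A ! i) (b \<noteq> odd i)) ?V)"
    by (rule sum.swap)
  also have "\<dots> = (\<Sum>i\<le>k. 1)"
    by (intro sum.cong refl sum_bary(2) finite_Union_box_complex[OF G] sub)
      (use Omega_coord[OF G B] in auto)
  finally show ?thesis by simp
qed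

lemma spread_map_support:
  assumes G: "pair_pseudo_graph G" and x: "x \<in> box_points (Omega k G)"
  shows "{w. spread_map G k x w \<noteq> 0} \<subseteq> carrier_simplex k {u. x u \<noteq> 0}"
proof
  fix w assume "w \<in> {w. spread_map G k x w \<noteq> 0}"
  then have "(\<Sum>u\<in>\<Union>(box_complex (Omega k G)). x u * spread k u w) \<noteq> 0"
    by (simp add: spread_map_def)
  then obtain u where u: "x u * spread k u w \<noteq> 0"
    by (metis (no_types, lifting) sum.neutral)
  then have "w \<in> carrier_simplex k {u}" using spread_nonzero[of k "fst u" "snd u" w] by simp
  moreover have "{u} \<subseteq> {u. x u \<noteq> 0}" using u by simp
  ultimately show "w \<in> carrier_simplex k {u. x u \<noteq> 0}" using carrier_simplex_mono by blast
qed

lemma Z2_map_spread_map: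
  assumes G: "pair_pseudo_graph G" and k: "k \<ge> 1"
  shows "Z2_map (box_space (Omega k G)) (box_space G) (spread_map G k)"
proof -
  note H = Omega_pseudo_graph[OF G, of k]
  let ?V = "\<Union>(box_complex G)" and ?W = "\<Union>(box_complex (Omega k G))"
  show ?thesis
    unfolding Z2_map_box_iff[OF H G]
  proof (intro conjI ballI)
    show "continuous_on (box_points (Omega k G)) (spread_map G k)"
      unfolding spread_map_def
      by (intro continuous_on_coordinatewise_then_product continuous_intros
          continuous_on_subset[OF continuous_on_product_coordinates]) auto
    fix x assume x: "x \<in> box_points (Omega k G)"
    then have x': "\<And>u. 0 \<le> x u" "{u. x u \<noteq> 0} \<in> box_complex (Omega k G)" "sum x ?W = 1"
      unfolding box_points_iff[OF H] by auto
    have "sum (spread_map G k x) ?V = (\<Sum>u\<in>?W. \<Sum>w\<in>?V. x u * spread k u w)"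
      unfolding spread_map_def by (rule sum.swap)
    also have "\<dots> = (\<Sum>u\<in>?W. x u * sum (spread k u) ?V)"
      by (simp add: sum_distrib_left)
    also have "\<dots> = (\<Sum>u\<in>?W. x u)"
    proof (rule sum.cong[OF refl])
      fix u assume "u \<in> ?W"
      then show "x u * sum (spread k u) ?V = x u"
        using sum_spread[OF G k, of "fst u" "snd u"] by simp
    qed
    finally have s: "sum (spread_map G k x) ?V = 1" using x'(3) by simp
    moreover have "0 \<le> spread_map G k x w" for w
      unfolding spread_map_def by (intro sum_nonneg mult_nonneg_nonneg x'(1) spread_nonneg)
    moreover have "{w. spread_map G k x w \<noteq> 0} \<in> box_complex G"
    proof (rule box_complex_subset[OF G carrier_simplex_box_complex[OF G k x'(2)] spread_map_support[OF G x]])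
      show "{w. spread_map G k x w \<noteq> 0} \<noteq> {}"
        using s by (metis (mono_tags, lifting) empty_iff mem_Collect_eq sum.neutral zero_neq_one)
    qed
    ultimately show "spread_map G k x \<in> box_points G"
      by (simp add: box_points_iff[OF G])
    show "spread_map G k (flip x) = flip (spread_map G k x)"
    proof
      fix w :: "'a \<times> bool"
      obtain v c where w: "w = (v, c)" by force
      show "spread_map G k (flip x) w = flip (spread_map G k x) w"
        unfolding spread_map_def w flip_apply Union_box_complex[OF H]
        by (rule sum.reindex_bij_witness[where i = "\<lambda>(v, b). (v, \<not> b)" and j = "\<lambda>(v, b). (v, \<not> b)"])
          (auto simp: spread_flip[symmetric])
    qed
  qed
qed

lemma spread_map_homotopic:
  assumes G: "pair_pseudo_graph G" and k: "k \<ge> 1"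
  shows "Z2_homotopic (box_space (Omega k G)) (box_space G) (spread_map G k) (box_map (Omega k G) Omega_proj)"
proof (rule Z2_homotopic_linear[OF _ G Z2_map_spread_map[OF G k]])
  note H = Omega_pseudo_graph[OF G, of k]
  show "pair_pseudo_graph (Omega k G)" by (rule H)
  show "Z2_map (box_space (Omega k G)) (box_space G) (box_map (Omega k G) Omega_proj)"
    using H G Omega_proj_hom(2)[OF G] by (rule Z2_map_box_map)
  fix x assume x: "x \<in> box_points (Omega k G)"
  then have s: "{u. x u \<noteq> 0} \<in> box_complex (Omega k G)" by (simp add: box_points_iff[OF H])
  have "(w, b) \<in> carrier_simplex k {u. x u \<noteq> 0}" if nz: "box_map (Omega k G) Omega_proj x (w, b) \<noteq> 0" for w b
  proof -
    obtain A where A: "x (A, b) \<noteq> 0" "Omega_proj A = w"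
      using nz unfolding box_map_nonzero[OF H x] by blast
    then have "(A, b) \<in> {u. x u \<noteq> 0}" by simp
    then obtain B where "(A, B) \<in> parcs (Omega k G)" using box_complex_arc[OF H s] by blast
    then have "w \<in> A ! 0" using A(2) zigzag_nonempty[of A B k G 0] by (simp add: zigzag_def)
    then show ?thesis using A(1) by (intro carrier_simplexI[of A b _ 0]) auto
  qed
  then have "{u. spread_map G k x u \<noteq> 0} \<union> {u. box_map (Omega k G) Omega_proj x u \<noteq> 0}
      \<subseteq> carrier_simplex k {u. x u \<noteq> 0}"
    using spread_map_support[OF G x] by auto
  then show "\<exists>\<sigma>\<in>box_complex G.
      {u. spread_map G k x u \<noteq> 0} \<union> {u. box_map (Omega k G) Omega_proj x u \<noteq> 0} \<subseteq> \<sigma>"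
    using carrier_simplex_box_complex[OF G k s] by blast
qed

section \<open>Norm estimates\<close>

lemma L2_set_sum_le:
  assumes "finite I"
  shows "L2_set (\<lambda>w. \<Sum>i\<in>I. f i w) V \<le> (\<Sum>i\<in>I. L2_set (f i) V)"
  using assms
proof (induction I rule: finite_induct)
  case (insert i I)
  have "L2_set (\<lambda>w. f i w + (\<Sum>j\<in>I. f j w)) V \<le> L2_set (f i) V + L2_set (\<lambda>w. \<Sum>j\<in>I. f j w) V"
    by (rule L2_set_triangle_ineq)
  then show ?case using insert by simp
qed (simp add: L2_set_def)

lemma L2_set_scale: "L2_set (\<lambda>w. c * f w) V = \<bar>c\<bar> * L2_set f V"
  unfolding L2_set_def by (simp add: power_mult_distrib sum_distrib_left[symmetric] real_sqrt_mult)

lemma L2_set_minus_commute: "L2_set (\<lambda>w. f w - g w) V = L2_set (\<lambda>w. g w - f w) V"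
  by (simp add: L2_set_def power2_commute)

lemma L2_set_diff_triangle:
  "L2_set (\<lambda>w. f w - h w) V \<le> L2_set (\<lambda>w. f w - g w) V + L2_set (\<lambda>w. g w - h w) V"
  using L2_set_triangle_ineq[of "\<lambda>w. f w - g w" "\<lambda>w. g w - h w" V] by simp

text \<open>Consecutive terms have opposite signs, so they pair up to steps of \<open>f\<close>,
  with at most one term left over.\<close>

lemma L2_set_alternating_sum:
  fixes f :: "nat \<Rightarrow> 'a \<Rightarrow> real"
  assumes K: "\<And>i. i \<le> n \<Longrightarrow> L2_set (f i) V \<le> K"
  shows "L2_set (\<lambda>w. \<Sum>i\<le>n. (- 1) ^ i * f i w) V \<le> K + (\<Sum>i<n. L2_set (\<lambda>w. f (Suc i) w - f i w) V)"
proof -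
  define S where "S n w = (\<Sum>i\<le>n. (- 1) ^ i * f i w)" for n w
  have K0: "0 \<le> K" using K[of 0] L2_set_nonneg[of "f 0" V] by linarith
  \<comment> \<open>Pairing advances two indices at a time, so the induction treats
    \<open>S m\<close> together with \<open>S m\<close> minus its last term. The latter is the
    preceding partial sum, and 0 for \<open>m = 0\<close>.\<close>
  have "L2_set (S m) V \<le> K + (\<Sum>i<m. L2_set (\<lambda>w. f (Suc i) w - f i w) V) \<and>
      L2_set (\<lambda>w. S m w - (- 1) ^ m * f m w) V \<le> K + (\<Sum>i<m. L2_set (\<lambda>w. f (Suc i) w - f i w) V)"
    if "m \<le> n" for m
    using that
  proof (induction m)
    case 0
    then show ?case using K[of 0] K0 by (simp add: S_def L2_set_def)
  next
    case (Suc m)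
    let ?d = "\<lambda>w. f (Suc m) w - f m w"
    have "S (Suc m) = (\<lambda>w. (S m w - (- 1) ^ m * f m w) + (- 1) ^ Suc m * ?d w)"
      by (auto simp: S_def algebra_simps)
    then have "L2_set (S (Suc m)) V \<le>
        L2_set (\<lambda>w. S m w - (- 1) ^ m * f m w) V + L2_set (\<lambda>w. (- 1) ^ Suc m * ?d w) V"
      using L2_set_triangle_ineq by metis
    also have "L2_set (\<lambda>w. (- 1) ^ Suc m * ?d w) V = L2_set ?d V"
      unfolding L2_set_scale by (simp add: power_abs)
    finally have 1: "L2_set (S (Suc m)) V \<le> L2_set (\<lambda>w. S m w - (- 1) ^ m * f m w) V + L2_set ?d V" .
    have 2: "(\<lambda>w. S (Suc m) w - (- 1) ^ Suc m * f (Suc m) w) = S m"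
      by (auto simp: S_def)
    show ?case
      unfolding 2 using 1 Suc.IH Suc.prems L2_set_nonneg[of ?d V] by (simp, linarith)
  qed
  from this[of n] show ?thesis by (simp add: S_def[abs_def])
qed

text \<open>Coordinates lie between 0 and 1, so each barycentre has squared norm at most its total
  weight, which is at most 1; the cross term of the square has a favourable sign.\<close>

lemma L2_set_bary_diff:
  assumes "finite V" "finite C" "C \<noteq> {}" "finite C'" "C' \<noteq> {}"
  shows "L2_set (\<lambda>u. bary C c u - bary C' c' u) V \<le> sqrt 2"
proof -
  have le1: "bary C c u \<le> 1" if "finite C" "C \<noteq> {}" for C :: "'a set" and c u
    using that by (auto simp: bary_def divide_le_eq_1 card_gt_0_iff Suc_le_eq)
  have sq: "(\<Sum>u\<in>V. (bary C c u)\<^sup>2) \<le> 1" if C: "finite C" "C \<noteq> {}" for C :: "'a set" and c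
  proof -
    have "(\<Sum>u\<in>V. (bary C c u)\<^sup>2) \<le> sum (bary C c) V"
      unfolding power2_eq_square
      by (intro sum_mono mult_left_le bary_nonneg le1 C)
    then show ?thesis using sum_bary(1)[OF assms(1) C] by (rule order_trans)
  qed
  have "(bary C c u - bary C' c' u)\<^sup>2 \<le> (bary C c u)\<^sup>2 + (bary C' c' u)\<^sup>2" for u
    using mult_nonneg_nonneg[OF bary_nonneg[of C c u] bary_nonneg[of C' c' u]]
    by (simp add: power2_diff)
  then have "(\<Sum>u\<in>V. (bary C c u - bary C' c' u)\<^sup>2) \<le> (\<Sum>u\<in>V. (bary C c u)\<^sup>2 + (bary C' c' u)\<^sup>2)"
    by (intro sum_mono)
  also have "\<dots> \<le> 2"
    using sq[OF assms(2,3), of c] sq[OF assms(4,5), of c'] by (simp add: sum.distrib)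
  finally show ?thesis unfolding L2_set_def by (rule real_sqrt_le_mono)
qed

text \<open>Equal sets contribute nothing, and otherwise the cardinality grows by at least 1, so the
  distance bound \<open>sqrt 2\<close> can be charged to a quantity that telescopes along a
  chain.\<close>

lemma L2_set_bary_diff_subset:
  assumes "finite V" "finite C'" "C \<subseteq> C'" "C \<noteq> {}"
  shows "L2_set (\<lambda>u. bary C' c u - bary C c u) V \<le> sqrt 2 * (real (card C') - real (card C))"
proof (cases "C = C'")
  case False
  then have "card C < card C'" using assms by (intro psubset_card_mono) auto
  then have "sqrt 2 * 1 \<le> sqrt 2 * (real (card C') - real (card C))"
    by (intro mult_left_mono) auto
  moreover have "L2_set (\<lambda>u. bary C' c u - bary C c u) V \<le> sqrt 2"
    using assms by (intro L2_set_bary_diff) (auto intro: finite_subset)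
  ultimately show ?thesis by linarith
qed (simp add: L2_set_def)

lemma card_le_max_degree:
  assumes G: "pair_pseudo_graph G" and w: "\<And>v. v \<in> C \<Longrightarrow> (w, v) \<in> parcs G" and ne: "C \<noteq> {}"
  shows "card C \<le> max_degree G"
proof -
  interpret pair_pseudo_graph G by fact
  have wv: "w \<in> pverts G" using w ne in_arcsD1 by blast
  have "Pair w ` C \<subseteq> out_arcs (with_proj G) w"
    using w by (auto simp: out_arcs_def)
  then have "card (Pair w ` C) \<le> out_degree (with_proj G) w"
    unfolding out_degree_def by (rule card_mono[OF finite_out_arcs])
  moreover have "card (Pair w ` C) = card C"
    by (intro card_image inj_onI) simp
  moreover have "out_degree (with_proj G) w \<le> max_degree G"
    unfolding max_degree_def using wv pair_finite_verts by (intro Max_ge) auto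
  ultimately show ?thesis by simp
qed

text \<open>The last set of the chain is joined to the opposite chain, which contains
  \<open>Omega_proj B\<close>; so all of it lies in one neighbourhood.\<close>

lemma card_zigzag:
  assumes G: "pair_pseudo_graph G" and AB: "(A, B) \<in> parcs (Omega k G)"
  shows "card (zigzag A B k) \<le> max_degree G"
proof (rule card_le_max_degree[OF G])
  show "(Omega_proj B, v) \<in> parcs G" if "v \<in> zigzag A B k" for v
    using zigzag_joined[OF G Omega_arc_sym[OF G AB] order_refl order_refl]
      zigzag_nonempty[OF Omega_arc_sym[OF G AB] order_refl] that
    by (auto simp: joined_def)
  show "zigzag A B k \<noteq> {}" using zigzag_nonempty[OF AB order_refl] by blast
qed

lemma finite_zigzag:
  assumes "pair_pseudo_graph G" "(A, B) \<in> parcs (Omega k G)" "i \<le> k"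
  shows "finite (zigzag A B i)"
  using Omega_coord(1)[OF assms] Omega_coord(1)[OF assms(1) Omega_arc_sym[OF assms(1,2)] assms(3)]
  by (simp add: zigzag_def)

text \<open>The difference is an alternating sum along the two chains; the cardinalities, which telescope,
  bound its total variation.\<close>

lemma spread_dist_arc:
  assumes G: "pair_pseudo_graph G" and AB: "(A, B) \<in> parcs (Omega k G)" and V: "finite V"
  shows "L2_set (\<lambda>w. spread k (A, b) w - spread k (B, \<not> b) w) V
    \<le> sqrt 2 * (2 * real (max_degree G) - 1) / (real k + 1)"
proof -
  note BA = Omega_arc_sym[OF G AB]
  define e where "e i w = bary (zigzag A B i) b w - bary (zigzag B A i) (\<not> b) w" for i w
  have diff: "spread k (A, b) w - spread k (B, \<not> b) w = 1 / (real k + 1) * (\<Sum>i\<le>k. (- 1) ^ i * e i w)" for w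
  proof -
    \<comment> \<open>At odd indices the two chains exchange coordinates: the one from
      \<open>A\<close> passes through \<open>B ! i\<close>, which the spread of
      \<open>(B, \<not> b)\<close> places on side \<open>b\<close>. The exchange is the
      sign.\<close>
    have "bary (A ! i) (b \<noteq> odd i) w - bary (B ! i) ((\<not> b) \<noteq> odd i) w = (- 1) ^ i * e i w" for i
      by (cases "even i") (auto simp: e_def zigzag_def)
    then have "(\<Sum>i\<le>k. (- 1) ^ i * e i w) =
        (\<Sum>i\<le>k. bary (A ! i) (b \<noteq> odd i) w) - (\<Sum>i\<le>k. bary (B ! i) ((\<not> b) \<noteq> odd i) w)"
      by (simp only: sum_subtractf[symmetric])
    then show ?thesis
      unfolding spread_def prod.case by (simp add: diff_divide_distrib add.commute)
  qed
  have eq: "L2_set (\<lambda>w. spread k (A, b) w - spread k (B, \<not> b) w) V =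
      L2_set (\<lambda>w. \<Sum>i\<le>k. (- 1) ^ i * e i w) V / (real k + 1)"
    unfolding diff L2_set_scale by simp
  have ne: "zigzag A B i \<noteq> {}" "zigzag B A i \<noteq> {}" if "i \<le> k" for i
    using zigzag_nonempty[OF AB that] zigzag_nonempty[OF BA that] by auto
  have step: "L2_set (\<lambda>w. e (Suc i) w - e i w) V \<le>
      sqrt 2 * (real (card (zigzag A B (Suc i))) + real (card (zigzag B A (Suc i)))) -
      sqrt 2 * (real (card (zigzag A B i)) + real (card (zigzag B A i)))" if i: "i < k" for i
  proof -
    have "(\<lambda>w. e (Suc i) w - e i w) = (\<lambda>w. (bary (zigzag A B (Suc i)) b w - bary (zigzag A B i) b w) +
        (bary (zigzag B A i) (\<not> b) w - bary (zigzag B A (Suc i)) (\<not> b) w))"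
      by (auto simp: e_def)
    then have "L2_set (\<lambda>w. e (Suc i) w - e i w) V \<le>
        L2_set (\<lambda>w. bary (zigzag A B (Suc i)) b w - bary (zigzag A B i) b w) V +
        L2_set (\<lambda>w. bary (zigzag B A i) (\<not> b) w - bary (zigzag B A (Suc i)) (\<not> b) w) V"
      by (simp only: L2_set_triangle_ineq)
    moreover have "L2_set (\<lambda>w. bary (zigzag A B (Suc i)) b w - bary (zigzag A B i) b w) V \<le>
        sqrt 2 * (real (card (zigzag A B (Suc i))) - real (card (zigzag A B i)))"
      using i ne by (intro L2_set_bary_diff_subset V finite_zigzag[OF G AB] zigzag_mono[OF AB]) auto
    moreover have "L2_set (\<lambda>w. bary (zigzag B A i) (\<not> b) w - bary (zigzag B A (Suc i)) (\<not> b) w) V \<le>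
        sqrt 2 * (real (card (zigzag B A (Suc i))) - real (card (zigzag B A i)))"
      using i ne unfolding L2_set_minus_commute[of "bary (zigzag B A i) (\<not> b)"]
      by (intro L2_set_bary_diff_subset V finite_zigzag[OF G BA] zigzag_mono[OF BA]) auto
    ultimately show ?thesis by (simp add: algebra_simps)
  qed
  have "L2_set (e i) V \<le> sqrt 2" if "i \<le> k" for i
    unfolding e_def[abs_def]
    by (intro L2_set_bary_diff V ne finite_zigzag[OF G AB] finite_zigzag[OF G BA] that)
  then have "L2_set (\<lambda>w. \<Sum>i\<le>k. (- 1) ^ i * e i w) V \<le>
      sqrt 2 + (\<Sum>i<k. L2_set (\<lambda>w. e (Suc i) w - e i w) V)"
    by (rule L2_set_alternating_sum)
  also have "\<dots> \<le> sqrt 2 + (\<Sum>i<k.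
      sqrt 2 * (real (card (zigzag A B (Suc i))) + real (card (zigzag B A (Suc i)))) -
      sqrt 2 * (real (card (zigzag A B i)) + real (card (zigzag B A i))))"
    by (intro add_left_mono sum_mono step) simp
  \<comment> \<open>Both chains start at singletons, so 2 is subtracted from the final
    cardinalities; together with the initial \<open>sqrt 2\<close> this leaves the summand
    -1.\<close>
  also have "\<dots> = sqrt 2 + (sqrt 2 * (real (card (zigzag A B k)) + real (card (zigzag B A k))) - sqrt 2 * 2)"
    by (subst sum_lessThan_telescope) (simp add: zigzag_0[OF AB] zigzag_0[OF BA])
  also have "\<dots> = sqrt 2 * (real (card (zigzag A B k)) + real (card (zigzag B A k)) - 1)"
    by (simp add: algebra_simps)
  also have "\<dots> \<le> sqrt 2 * (2 * real (max_degree G) - 1)"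
    using card_zigzag[OF G AB] card_zigzag[OF G BA] by (intro mult_left_mono) auto
  finally show ?thesis
    unfolding eq by (intro divide_right_mono) auto
qed

text \<open>Vertices of a simplex on opposite sides are adjacent tuples; on the same side they share
  a neighbour, at the cost of a factor 2. Rounding \<open>2 * sqrt 2\<close> up to 3 then produces
  the constant 6.\<close>

lemma spread_dist:
  assumes G: "pair_pseudo_graph G" and k: "k \<ge> 1" and V: "finite V"
    and \<sigma>: "\<sigma> \<in> box_complex (Omega k G)" and u: "u \<in> \<sigma>" "u' \<in> \<sigma>"
  shows "L2_set (\<lambda>w. spread k u w - spread k u' w) V \<le> (6 * real (max_degree G) - 3) / (real k + 1)"
proof -
  note H = Omega_pseudo_graph[OF G, of k]
  let ?d = "sqrt 2 * (2 * real (max_degree G) - 1) / (real k + 1)"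
  obtain A b A' b' where eq: "u = (A, b)" "u' = (A', b')" by (cases u; cases u')
  obtain B where B: "(A, B) \<in> parcs (Omega k G)"
    using box_complex_arc[OF H \<sigma>] u(1) eq by blast
  \<comment> \<open>An arc forces the maximum degree to be positive, so \<open>?d\<close> is
    nonnegative and doubling it is harmless for opposite sides.\<close>
  have "zigzag A B 0 \<subseteq> zigzag A B k" by (rule zigzag_mono[OF B]) auto
  then have "card (zigzag A B 0) \<le> card (zigzag A B k)"
    by (intro card_mono finite_zigzag[OF G B]) auto
  then have D: "max_degree G \<ge> 1"
    using card_zigzag[OF G B] by (simp add: zigzag_0[OF B])
  then have d0: "0 \<le> ?d" by simp
  have "L2_set (\<lambda>w. spread k u w - spread k u' w) V \<le> 2 * ?d"
  proof (cases "b' = b")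
    case True
    obtain C where C: "(A, C) \<in> parcs (Omega k G)" "(A', C) \<in> parcs (Omega k G)"
      using box_complexD(3)[OF H \<sigma>, of b] u eq True by blast
    have "L2_set (\<lambda>w. spread k u w - spread k u' w) V \<le>
        L2_set (\<lambda>w. spread k u w - spread k (C, \<not> b) w) V + L2_set (\<lambda>w. spread k (C, \<not> b) w - spread k u' w) V"
      by (rule L2_set_diff_triangle)
    also have "\<dots> \<le> ?d + ?d"
      using spread_dist_arc[OF G C(1) V, of b] spread_dist_arc[OF G C(2) V, of b]
      unfolding eq True L2_set_minus_commute[of "spread k (C, \<not> b)"] by (rule add_mono)
    finally show ?thesis by simp
  next
    case False
    then have b': "b' = (\<not> b)" by simp
    have "(A, A') \<in> parcs (Omega k G)"
      using box_complexD(2)[OF H \<sigma>, of A b A'] u unfolding eq b' by blast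
    from spread_dist_arc[OF G this V, of b] d0 show ?thesis unfolding eq b' by linarith
  qed
  also have "2 * ?d = (2 * sqrt 2) * (2 * real (max_degree G) - 1) / (real k + 1)" by simp
  also have "\<dots> \<le> 3 * (2 * real (max_degree G) - 1) / (real k + 1)"
  proof (intro divide_right_mono mult_right_mono)
    have "sqrt 2 \<le> 3 / 2" by (rule real_le_lsqrt) (simp_all add: power2_eq_square)
    then show "2 * sqrt 2 \<le> 3" by simp
  qed (use D in auto)
  finally show ?thesis by (simp add: algebra_simps)
qed

text \<open>Expanding with the weights \<open>x u * y u'\<close> writes the difference as a convex
  combination of the differences of \<open>f u\<close> and \<open>f u'\<close>.\<close>

lemma L2_set_convex_diff:
  assumes "finite \<sigma>" "\<And>u. u \<in> \<sigma> \<Longrightarrow> 0 \<le> x u" "sum x \<sigma> = 1" "\<And>u. u \<in> \<sigma> \<Longrightarrow> 0 \<le> y u" "sum y \<sigma> = 1"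
    and d: "\<And>u u'. u \<in> \<sigma> \<Longrightarrow> u' \<in> \<sigma> \<Longrightarrow> L2_set (\<lambda>w. f u w - f u' w) V \<le> d"
  shows "L2_set (\<lambda>w. (\<Sum>u\<in>\<sigma>. x u * f u w) - (\<Sum>u\<in>\<sigma>. y u * f u w)) V \<le> d"
proof -
  have "(\<Sum>u\<in>\<sigma>. x u * f u w) - (\<Sum>u\<in>\<sigma>. y u * f u w) =
      (\<Sum>p\<in>\<sigma> \<times> \<sigma>. x (fst p) * y (snd p) * (f (fst p) w - f (snd p) w))" for w
  proof -
    have "(\<Sum>p\<in>\<sigma> \<times> \<sigma>. x (fst p) * y (snd p) * (f (fst p) w - f (snd p) w)) =
        (\<Sum>u\<in>\<sigma>. \<Sum>u'\<in>\<sigma>. x u * f u w * y u') - (\<Sum>u\<in>\<sigma>. \<Sum>u'\<in>\<sigma>. x u * (y u' * f u' w))"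
      by (simp add: sum.cartesian_product' sum_subtractf[symmetric] algebra_simps)
    then show ?thesis
      by (simp add: sum_distrib_left[symmetric] sum_distrib_right[symmetric] assms(3,5))
  qed
  then have "L2_set (\<lambda>w. (\<Sum>u\<in>\<sigma>. x u * f u w) - (\<Sum>u\<in>\<sigma>. y u * f u w)) V \<le>
      (\<Sum>p\<in>\<sigma> \<times> \<sigma>. L2_set (\<lambda>w. x (fst p) * y (snd p) * (f (fst p) w - f (snd p) w)) V)"
    using L2_set_sum_le[of "\<sigma> \<times> \<sigma>" "\<lambda>p w. x (fst p) * y (snd p) * (f (fst p) w - f (snd p) w)" V] assms(1)
    by simp
  also have "\<dots> \<le> (\<Sum>p\<in>\<sigma> \<times> \<sigma>. x (fst p) * y (snd p) * d)"
    unfolding L2_set_scale using assms by (intro sum_mono mult_mono) (auto simp: abs_mult)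
  also have "\<dots> = (\<Sum>u\<in>\<sigma>. x u * (\<Sum>u'\<in>\<sigma>. y u')) * d"
    by (simp add: sum.cartesian_product' sum_distrib_left sum_distrib_right)
  also have "\<dots> = d"
    using assms(3,5) by simp
  finally show ?thesis .
qed

lemma mdiameter_spread_map:
  assumes G: "pair_pseudo_graph G" and k: "k \<ge> 1" and \<sigma>: "\<sigma> \<in> box_complex (Omega k G)"
  shows "mdiameter (box_real G) (spread_map G k ` geom_simplex \<sigma>) < 6 * real (max_degree G) / real k"
proof -
  note H = Omega_pseudo_graph[OF G, of k]
  let ?V = "\<Union>(box_complex G)" and ?W = "\<Union>(box_complex (Omega k G))"
  let ?d = "(6 * real (max_degree G) - 3) / (real k + 1)"
  note finV = finite_Union_box_complex[OF G] and finW = finite_Union_box_complex[OF H]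
  have sub: "\<sigma> \<subseteq> ?W" using \<sigma> by blast
  then have fin: "finite \<sigma>" using finW by (rule finite_subset)
  obtain A b where Ab: "(A, b) \<in> \<sigma>" using box_complexD(1)[OF H \<sigma>] by auto
  \<comment> \<open>A point of the simplex, so that \<open>mdiameter\<close> of the image is the
    supremum and not the default 0.\<close>
  then have "basis_vec (A, b) \<in> geom_simplex \<sigma>"
    using fin by (auto simp: geom_simplex_iff basis_vec_def)
  then have ne: "spread_map G k ` geom_simplex \<sigma> \<noteq> {}" by blast
  have "mdist (box_real G) (spread_map G k x) (spread_map G k y) \<le> ?d"
    if x: "x \<in> geom_simplex \<sigma>" and y: "y \<in> geom_simplex \<sigma>" for x y
  proof -
    have eq: "spread_map G k x w = (\<Sum>u\<in>\<sigma>. x u * spread k u w)" if "x \<in> geom_simplex \<sigma>" for x w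
      unfolding spread_map_def using that fin sub finW
      by (intro sum.mono_neutral_right) (auto simp: geom_simplex_iff)
    have "L2_set (\<lambda>w. (\<Sum>u\<in>\<sigma>. x u * spread k u w) - (\<Sum>u\<in>\<sigma>. y u * spread k u w)) ?V \<le> ?d"
      using x y fin spread_dist[OF G k finV \<sigma>]
      by (intro L2_set_convex_diff) (auto simp: geom_simplex_iff)
    then show ?thesis
      by (simp add: box_real_def realization_def vec_metric_simps[OF finV] eq x y)
  qed
  then have "mdiameter (box_real G) (spread_map G k ` geom_simplex \<sigma>) \<le> ?d"
    unfolding mdiameter_def using ne by (auto intro!: cSUP_least)
  also have "\<dots> < 6 * real (max_degree G) / real k"
  proof -
    \<comment> \<open>The sides differ by 6 times the maximum degree plus \<open>3 * k\<close>,
      which is positive even when the degree is 0.\<close>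
    have "(6 * real (max_degree G) - 3) * real k < 6 * real (max_degree G) * (real k + 1)"
      using k by (simp add: algebra_simps)
    then show ?thesis using k by (simp add: divide_simps)
  qed
  finally show ?thesis .
qed

theorem theorem6p1:
  fixes G :: "'a pair_pre_digraph" and D k :: nat
  assumes "pair_graph G"
    and "D = max_degree G"
    and "k \<ge> 1"
  shows "\<exists>g. Z2_map (box_space (Omega k G)) (box_space G) g \<and>
      Z2_homotopic (box_space (Omega k G)) (box_space G) g (box_map (Omega k G) Omega_proj) \<and>
      Z2_homotopy_equivalence (box_space (Omega k G)) (box_space G) g \<and>
      (\<forall>\<sigma>\<in>box_complex (Omega k G).
         mdiameter (box_real G) (g ` geom_simplex \<sigma>) < 6 * real D / real k)"
proof -
  interpret pair_graph G by fact
  have G: "pair_pseudo_graph G" by unfold_locales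
  note hom = spread_map_homotopic[OF G assms(3)]
  show ?thesis
    using Z2_map_spread_map[OF G assms(3)] hom mdiameter_spread_map[OF G assms(3)] assms(2)
      Z2_homotopy_equivalence_homotopic[OF Omega_proj_equivalence[OF G] hom]
    by blast
qed

end
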